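(* Let $n\ge 1$, let $A=(a_{ij})$ be a $2n\times 2n$ skew-symmetric matrix, and let $\vec p_A=(p_n,p_{n-1},\ldots,p_0)$ be its Pfaffian coefficient sequence produced by the PB algorithm. Then for $1\le k\le n-1$, $$p_{n-k}=\sum_{\bar C}\operatorname{sgn}(\bar C)\,w_A(\bar C)+\sum_{\bar C'}\operatorname{sgn}(\bar C')\,w_A(\bar C'),$$ where $\bar C$ ranges over all pclow sequences on $[2n]$ of length $2k$ whose first pclow has head $1$, and $\bar C'$ ranges over all pclow sequences of length $2k$ all of whose vertices lie in $\{3,4,\ldots,2n\}$ (with arbitrary first head). Moreover $$p_0=\sum_{\bar C}\operatorname{sgn}(\bar C)\,w_A(\bar C),$$ where $\bar C$ ranges over all pclow sequences on $[2n]$ of length $2n$ whose first pclow has head $1$. Hence $\operatorname{pf}(A)=p_0$.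
   Context: Matrices have entries in a commutative ring with $1$; skew-symmetric means $a_{ji}=-a_{ij}$ and $a_{ii}=0$. $[2n]=\{1,\dots,2n\}$. **Pfaffian.** $\operatorname{pf}(A)=\sum_{\sigma}\operatorname{sgn}(\sigma)a_{\sigma(1)\sigma(2)}\cdots a_{\sigma(2n-1)\sigma(2n)}$, the sum being over permutations $\sigma$ of $[2n]$ with $\sigma(1)<\sigma(3)<\cdots<\sigma(2n-1)$ and $\sigma(2i-1)<\sigma(2i)$ for all $i$ (i.e. over perfect matchings of $[2n]$). **PB algorithm.** $J_1=\begin{pmatrix}0&1\\-1&0\end{pmatrix}$ and $J_m$ is the $2m\times 2m$ block diagonal matrix with $m$ diagonal blocks $J_1$. If $n=1$, $\vec p_A=(1,a_{12})$. If $n\ge 2$, write $$A=\begin{pmatrix}0&a_{12}&R\\-a_{12}&0&-{}^tS\\-{}^tR&S&M\end{pmatrix}$$ with $R$ a row vector of length $2n-2$, $S$ a column vector of length $2n-2$, and $M$ skew-symmetric of size $(2n-2)\times(2n-2)$. Put $J=J_{n-1}$, $t_i=0$ for $i<0$, $t_0=1$, $t_1=a_{12}$, $t_i=RJ(MJ)^{i-2}S$ for $i\ge 2$. Let $P_A$ be the $(n+1)\times n$ lower triangular Toeplitz matrix with $(r,c)$ entry $t_{r-c}$. Then (as column vectors) $\vec p_A=P_A\,\vec p_M$, and the entries of $\vec p_A$ are indexed $(p_n,p_{n-1},\ldots,p_0)$. **Pclows.** A pclow (on a set of vertices in $[2n]$) is a closed walk $C=\langle e_1,e_2,\ldots,e_{2m}\rangle$,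 $m\ge1$, with $e_1=(i_1,i_2),e_2=(i_2,i_3),\ldots,e_{2m}=(i_{2m},i_1)$, $i_1<i_k$ for all $2\le k\le 2m$, such that each even-numbered edge $e_{2k}$ is of the form $(2j-1,2j)$ or $(2j,2j-1)$ (so each pair $(e_{2k-1},e_{2k})$ is $(i,2j-1),(2j-1,2j)$ or $(i,2j),(2j,2j-1)$). Loops $(i,i)$ are not used as edges (they would have weight $0$). The head of $C$ is $\operatorname{head}(C)=i_1$. With $\operatorname{fd}(C)$ the number of $k$ such that $e_k=(i,j)$ has $i<j$, put $\operatorname{sgn}(C)=(-1)^{\operatorname{fd}(C)+1}$. With $a^+_{ij}=a_{ij}$ if $i<j$ and $a^+_{ij}=a_{ji}$ if $i>j$, the weight is $w_A(C)=\prod_{k=1}^m a^+_{e_{2k-1}}$. A pclow sequence is a sequence $\bar C=\langle C_1,\ldots,C_l\rangle$ of pclows with $\operatorname{head}(C_1)<\cdots<\operatorname{head}(C_l)$; $\operatorname{sgn}(\bar C)=\prod_i\operatorname{sgn}(C_i)$, $w_A(\bar C)=\prod_i w_A(C_i)$, and its length $|\bar C|$ is the total number of edges occurring (with multiplicity). *)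

theory Defs
  imports "Jordan_Normal_Form.Matrix" "HOL-Combinatorics.Permutations"
begin

text \<open>Matrices are zero-based in the library; here rows, columns and vertices are numbered from 1.\<close>

definition entry :: "'a mat \<Rightarrow> nat \<Rightarrow> nat \<Rightarrow> 'a" where
  "entry A i j = A $$ (i - 1, j - 1)"

definition skew_symmetric :: "nat \<Rightarrow> 'a::comm_ring_1 mat \<Rightarrow> bool" where
  "skew_symmetric N A \<longleftrightarrow> A \<in> carrier_mat N N \<and>
     (\<forall>i\<in>{1..N}. \<forall>j\<in>{1..N}. entry A j i = - entry A i j) \<and>
     (\<forall>i\<in>{1..N}. entry A i i = 0)"

definition pfaffian :: "nat \<Rightarrow> 'a::comm_ring_1 mat \<Rightarrow> 'a" where
  "pfaffian n A =
     (\<Sum>\<sigma> | \<sigma> permutes {1..2*n} \<and>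
           (\<forall>i\<in>{1..<n}. \<sigma> (2*i - 1) < \<sigma> (2*i + 1)) \<and>
           (\<forall>i\<in>{1..n}. \<sigma> (2*i - 1) < \<sigma> (2*i)).
        of_int (sign \<sigma>) * (\<Prod>i=1..n. entry A (\<sigma> (2*i - 1)) (\<sigma> (2*i))))"


section \<open>The PB algorithm\<close>

definition J1 :: "'a::comm_ring_1 mat" where
  "J1 = mat_of_rows_list 2 [[0, 1], [-1, 0]]"

definition Jmat :: "nat \<Rightarrow> 'a::comm_ring_1 mat" where
  "Jmat m = diag_block_mat (replicate m J1)"

text \<open>The blocks of a matrix of size \<open>2 * n\<close>. The second row of \<open>A\<close> is \<open>(- a\<^sub>1\<^sub>2, 0, - S)\<close>, so
  \<open>S\<close> is read off the second column.\<close>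

definition blockR :: "nat \<Rightarrow> 'a mat \<Rightarrow> 'a vec" where
  "blockR n A = vec (2*n - 2) (\<lambda>j. entry A 1 (j + 3))"

definition blockS :: "nat \<Rightarrow> 'a mat \<Rightarrow> 'a vec" where
  "blockS n A = vec (2*n - 2) (\<lambda>i. entry A (i + 3) 2)"

definition blockM :: "nat \<Rightarrow> 'a mat \<Rightarrow> 'a mat" where
  "blockM n A = mat (2*n - 2) (2*n - 2) (\<lambda>(i, j). entry A (i + 3) (j + 3))"

definition toeplitz_coeff :: "nat \<Rightarrow> 'a::comm_ring_1 mat \<Rightarrow> int \<Rightarrow> 'a" where
  "toeplitz_coeff n A i =
     (if i < 0 then 0
      else if i = 0 then 1
      else if i = 1 then entry A 1 2
      else blockR n A \<bullet>
        ((Jmat (n - 1) * (blockM n A * Jmat (n - 1)) ^\<^sub>m nat (i - 2)) *\<^sub>v blockS n A))"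

definition toeplitz_mat :: "nat \<Rightarrow> 'a::comm_ring_1 mat \<Rightarrow> 'a mat" where
  "toeplitz_mat n A = mat (n + 1) n (\<lambda>(r, c). toeplitz_coeff n A (int r - int c))"

text \<open>The equation for \<open>n = 0\<close> only makes the function total.\<close>

fun PB :: "nat \<Rightarrow> 'a::comm_ring_1 mat \<Rightarrow> 'a vec" where
  "PB 0 A = vec_of_list [1]"
| "PB (Suc 0) A = vec_of_list [1, entry A 1 2]"
| "PB (Suc (Suc m)) A =
     toeplitz_mat (Suc (Suc m)) A *\<^sub>v PB (Suc m) (blockM (Suc (Suc m)) A)"

text \<open>The entries of the vector \<open>PB n A\<close> are indexed \<open>(p\<^sub>n, p\<^bsub>n-1\<^esub>, \<dots>, p\<^sub>0)\<close>.\<close>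

definition pf_coeff :: "nat \<Rightarrow> 'a::comm_ring_1 mat \<Rightarrow> nat \<Rightarrow> 'a" where
  "pf_coeff n A j = PB n A $ (n - j)"


section \<open>Pclows\<close>

type_synonym edge = "nat \<times> nat"

text \<open>A walk is its list of edges \<open>e\<^sub>1, \<dots>, e\<^bsub>2m\<^esub>\<close>, with \<open>e\<^sub>k\<close> stored at list position \<open>k - 1\<close>; hence
  the even-numbered edges sit at the odd list positions.\<close>

definition pclow :: "nat set \<Rightarrow> edge list \<Rightarrow> bool" where
  "pclow V C \<longleftrightarrow>
     (\<exists>m\<ge>1. length C = 2 * m \<and>
       (\<forall>e\<in>set C. fst e \<in> V \<and> snd e \<in> V \<and> fst e \<noteq> snd e) \<and>
       (\<forall>k<2*m. snd (C ! k) = fst (C ! (Suc k mod (2*m)))) \<and>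
       (\<forall>k\<in>{1..<2*m}. fst (C ! 0) < fst (C ! k)) \<and>
       (\<forall>k\<in>{1..m}. \<exists>j\<ge>1. C ! (2*k - 1) = (2*j - 1, 2*j) \<or> C ! (2*k - 1) = (2*j, 2*j - 1)))"

definition head :: "edge list \<Rightarrow> nat" where
  "head C = fst (C ! 0)"

definition fd :: "edge list \<Rightarrow> nat" where
  "fd C = card {k. k < length C \<and> fst (C ! k) < snd (C ! k)}"

definition pclow_sgn :: "edge list \<Rightarrow> 'a::comm_ring_1" where
  "pclow_sgn C = (-1) ^ (fd C + 1)"

definition entry_plus :: "'a mat \<Rightarrow> edge \<Rightarrow> 'a" where
  "entry_plus A e =
     (if fst e < snd e then entry A (fst e) (snd e) else entry A (snd e) (fst e))"

definition pclow_weight :: "'a::comm_ring_1 mat \<Rightarrow> edge list \<Rightarrow> 'a" where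
  "pclow_weight A C = (\<Prod>k=1..length C div 2. entry_plus A (C ! (2*k - 2)))"

definition pclow_seq :: "nat set \<Rightarrow> edge list list \<Rightarrow> bool" where
  "pclow_seq V Cs \<longleftrightarrow> (\<forall>C\<in>set Cs. pclow V C) \<and> sorted_wrt (\<lambda>C D. head C < head D) Cs"

definition seq_sgn :: "edge list list \<Rightarrow> 'a::comm_ring_1" where
  "seq_sgn Cs = (\<Prod>C\<leftarrow>Cs. pclow_sgn C)"

definition seq_weight :: "'a::comm_ring_1 mat \<Rightarrow> edge list list \<Rightarrow> 'a" where
  "seq_weight A Cs = (\<Prod>C\<leftarrow>Cs. pclow_weight A C)"

definition seq_length :: "edge list list \<Rightarrow> nat" where
  "seq_length Cs = (\<Sum>C\<leftarrow>Cs. length C)"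

text \<open>Sums over pclow sequences of a given length are sums over finite sets.\<close>

lemma finite_pclow_seqs:
  assumes "finite V"
  shows "finite {Cs. pclow_seq V Cs \<and> seq_length Cs = L}"
proof -
  let ?E = "{C. set C \<subseteq> V \<times> V \<and> length C \<le> L}"
  have "finite ?E"
    using assms by (intro finite_lists_length_le) auto
  then have fin: "finite {Cs. set Cs \<subseteq> ?E \<and> length Cs \<le> L}"
    by (rule finite_lists_length_le)
  have len: "length Cs \<le> seq_length Cs" if "\<forall>C\<in>set Cs. pclow V C" for Cs
    using that
  proof (induction Cs)
    case (Cons C Cs)
    have "length C \<ge> 1"
      using Cons.prems by (auto simp: pclow_def)
    then show ?case
      using Cons by (auto simp: seq_length_def)
  qed (simp add: seq_length_def)
  have mem: "length C \<le> seq_length Cs" if "C \<in> set Cs" for C Cs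
    using that member_le_sum_list[of "length C" "map length Cs"]
    by (auto simp: seq_length_def)
  have "{Cs. pclow_seq V Cs \<and> seq_length Cs = L} \<subseteq> {Cs. set Cs \<subseteq> ?E \<and> length Cs \<le> L}"
  proof (rule subsetI)
    fix Cs assume a: "Cs \<in> {Cs. pclow_seq V Cs \<and> seq_length Cs = L}"
    have "C \<in> ?E" if C: "C \<in> set Cs" for C
    proof -
      have "pclow V C" using a C by (auto simp: pclow_seq_def)
      then have "set C \<subseteq> V \<times> V" by (auto simp: pclow_def)
      then show ?thesis using mem[OF C] a by auto
    qed
    moreover have "length Cs \<le> L" using len[of Cs] a by (auto simp: pclow_seq_def)
    ultimately show "Cs \<in> {Cs. set Cs \<subseteq> ?E \<and> length Cs \<le> L}" by blast
  qed
  then show ?thesis using fin by (rule finite_subset)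
qed

end

theory Submission
  imports Defs "HOL-Computational_Algebra.Formal_Power_Series"
begin

text \<open>Pclow sequences with the vertices \<open>{2s+1..2n}\<close> form a power series \<open>G\<^sub>s(x)\<close>, the length \<open>2k\<close> being
  marked by \<open>x\<^sup>k\<close>. Splitting off the pclow with the smallest possible head gives \<open>G\<^sub>s = T\<^sub>s G\<^bsub>s+1\<^esub>\<close>,
  where \<open>T\<^sub>s\<close> collects the coefficients \<open>t\<^sub>i\<close> of the PB algorithm, since \<open>t\<^sub>i\<close> is the signed sum of the
  pclows of length \<open>2i\<close> with head \<open>2s+1\<close>. On the other hand, clearing one row of \<open>J + x A\<close> shows that the
  Pfaffian of \<open>J + x A\<close>, restricted to \<open>{2s+1..2n}\<close>, obeys the same recursion. So \<open>G\<^sub>s\<close> is this Pfaffian,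
  a polynomial of degree at most \<open>n - s\<close> with the Pfaffian of \<open>A\<close> as its top coefficient; the vanishing
  of the higher coefficients is what allows the PB algorithm to truncate the Toeplitz matrix.\<close>

text \<open>The sums contain many sequences that correspond to no matching, and a combinatorial
  proof would cancel these by a sign-reversing involution. Here linear algebra does the cancelling.
  The entries of A need not be units, so A alone offers no pivot; but \<open>J\<close> is
  invertible, hence so is J + x M over power series, and a row can be cleared without dividing in
  the coefficient ring. The factor T_s is in general an infinite series, because arbitrarily long
  pclows with a given head exist. That the product T_s G_(s+1) has bounded degree is therefore
  invisible in the recursion and has to be read off the Pfaffian. Pfaffians are taken as functions
  of lists of indices, so that deleting, exchanging and repeating rows are operations on lists
  rather than on submatrices.\<close>

section \<open>Contractions and Pfaffians of lists\<close>

text \<open>Interior product with the covector \<phi>, for functions of lists in place of exterior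
  forms. The recursion carries the alternating sign implicitly; positions appear only in
  \<open>contract_conv_sum\<close>, where permutations come in.\<close>

primrec contract :: "('i \<Rightarrow> 'a::comm_ring_1) \<Rightarrow> ('i list \<Rightarrow> 'a) \<Rightarrow> 'i list \<Rightarrow> 'a" where
  "contract \<phi> F [] = 0"
| "contract \<phi> F (y # ys) = \<phi> y * F ys - contract \<phi> (\<lambda>zs. F (y # zs)) ys"

lemma contract_zero: "contract \<phi> (\<lambda>_. 0) ys = 0"
  by (induction ys) auto

lemma contract_diff: "contract \<phi> (\<lambda>zs. F zs - G zs) ys = contract \<phi> F ys - contract \<phi> G ys"
  by (induction ys arbitrary: F G) (auto simp: algebra_simps)

lemma contract_uminus: "contract \<phi> (\<lambda>zs. - F zs) ys = - contract \<phi> F ys"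
  by (induction ys arbitrary: F) (auto simp: algebra_simps)

lemma contract_scale: "contract \<phi> (\<lambda>zs. c * F zs) ys = c * contract \<phi> F ys"
  by (induction ys arbitrary: F) (auto simp: algebra_simps)

lemma contract_add_left: "contract (\<lambda>x. \<phi> x + \<psi> x) F ys = contract \<phi> F ys + contract \<psi> F ys"
  by (induction ys arbitrary: F) (auto simp: algebra_simps)

lemma contract_scale_left: "contract (\<lambda>x. c * \<phi> x) F ys = c * contract \<phi> F ys"
  by (induction ys arbitrary: F) (auto simp: algebra_simps)

lemma contract_sum_left:
  "finite K \<Longrightarrow> contract (\<lambda>x. \<Sum>k\<in>K. \<phi> k x) F ys = (\<Sum>k\<in>K. contract (\<phi> k) F ys)"
proof (induction K rule: finite_induct)
  case empty
  have "contract (\<lambda>x. 0 * (0::'b)) F ys = 0 * contract (\<lambda>x. 0) F ys"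
    by (rule contract_scale_left)
  then show ?case by simp
qed (simp add: contract_add_left)

lemma contract_eq_0: "(\<And>y. y \<in> set ys \<Longrightarrow> \<phi> y = 0) \<Longrightarrow> contract \<phi> F ys = 0"
  by (induction ys arbitrary: F) auto

lemma contract_contract_Cons:
  "contract \<phi> (contract \<psi> F) (y # ys) =
     \<phi> y * contract \<psi> F ys - \<psi> y * contract \<phi> F ys + contract \<phi> (contract \<psi> (\<lambda>zs. F (y # zs))) ys"
  by (simp add: contract_diff contract_scale)

text \<open>Interior products anticommute: in \<open>contract_contract_Cons\<close> the first two
  terms change sign when \<phi> and \<psi> are exchanged, and the last one does so by
  induction.\<close>

lemma contract_contract_swap:
  "contract \<phi> (contract \<psi> F) ys = - contract \<psi> (contract \<phi> F) ys"
proof (induction ys arbitrary: F)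
  case (Cons y ys)
  show ?case
    by (simp only: contract_contract_Cons Cons.IH[of "\<lambda>zs. F (y # zs)"]) simp
qed simp

text \<open>This does not follow from \<open>contract_contract_swap\<close>, since 2 may be a zero
  divisor or 0 in the ring.\<close>

lemma contract_contract_self: "contract \<phi> (contract \<phi> F) ys = 0"
proof (induction ys arbitrary: F)
  case (Cons y ys)
  show ?case by (simp only: contract_contract_Cons Cons.IH) simp
qed simp

lemma contract_conv_sum:
  "contract \<phi> F xs = (\<Sum>j<length xs. (- 1) ^ j * \<phi> (xs ! j) * F (take j xs @ drop (Suc j) xs))"
proof (induction xs arbitrary: F)
  case (Cons x xs)
  have "(\<Sum>j<length (x # xs). (- 1) ^ j * \<phi> ((x # xs) ! j) * F (take j (x # xs) @ drop (Suc j) (x # xs)))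
      = \<phi> x * F xs
        + (\<Sum>j<length xs. - ((- 1) ^ j * \<phi> (xs ! j) * F (x # take j xs @ drop (Suc j) xs)))"
    by (simp only: length_Cons sum.lessThan_Suc_shift) simp
  also have "\<dots> = contract \<phi> F (x # xs)"
    by (simp only: contract.simps Cons.IH sum_negf diff_conv_add_uminus)
  finally show ?case by (rule sym)
qed simp

section \<open>Alternating functions of lists\<close>

definition alternating :: "('i list \<Rightarrow> 'a::comm_ring_1) \<Rightarrow> bool" where
  "alternating F \<longleftrightarrow>
     (\<forall>us x y vs. F (us @ x # y # vs) = - F (us @ y # x # vs)) \<and> (\<forall>us x vs. F (us @ x # x # vs) = 0)"

lemma alternatingI:
  assumes "\<And>us x y vs. F (us @ x # y # vs) = - F (us @ y # x # vs)"
    and "\<And>us x vs. F (us @ x # x # vs) = 0"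
  shows "alternating F"
  unfolding alternating_def using assms by blast

lemma alternating_swap: "alternating F \<Longrightarrow> F (us @ x # y # vs) = - F (us @ y # x # vs)"
  unfolding alternating_def by blast

lemma alternating_same: "alternating F \<Longrightarrow> F (us @ x # x # vs) = 0"
  unfolding alternating_def by blast

lemma alternating_Cons: "alternating F \<Longrightarrow> alternating (\<lambda>zs. F (u # zs))"
  unfolding alternating_def by (metis append_Cons)

text \<open>The left copy of \<open>x\<close> moves right by exchanges of neighbours until it meets
  the other copy.\<close>

lemma alternating_repeat: "alternating F \<Longrightarrow> F (us @ x # vs @ x # ws) = 0"
proof (induction vs arbitrary: us)
  case Nil
  then show ?case by (simp add: alternating_same)
next
  case (Cons v vs)
  have "F (us @ x # v # vs @ x # ws) = - F (us @ v # x # vs @ x # ws)"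
    by (rule alternating_swap[OF Cons.prems])
  also have "\<dots> = 0"
    using Cons.IH[of "us @ [v]"] Cons.prems by simp
  finally show ?case by simp
qed

text \<open>Fixing the first element keeps a function alternating, so induction on the prefix
  \<open>us\<close> leaves only the two front elements, where the recursion of
  \<open>contract\<close> shows both of them.\<close>

lemma alternating_contract: "alternating F \<Longrightarrow> alternating (contract \<phi> F)"
proof -
  have A: "contract \<phi> F (us @ x # y # vs) = - contract \<phi> F (us @ y # x # vs)"
    if "alternating F" for us x y vs and F :: "'a list \<Rightarrow> 'b"
    using that
  proof (induction us arbitrary: F)
    case Nil
    have "F (x # y # zs) = - F (y # x # zs)" for zs
      using alternating_swap[OF Nil, of "[]" x y zs] by simp
    then show ?case by (simp add: contract_uminus)
  next
    case (Cons u us)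
    show ?case
      using Cons.IH[OF alternating_Cons[OF Cons.prems]] alternating_swap[OF Cons.prems, of us x y vs]
      by simp
  qed
  have B: "contract \<phi> F (us @ x # x # vs) = 0"
    if "alternating F" for us x vs and F :: "'a list \<Rightarrow> 'b"
    using that
  proof (induction us arbitrary: F)
    case Nil
    have "F (x # x # zs) = 0" for zs
      using alternating_same[OF Nil, of "[]" x zs] by simp
    then show ?case by (simp add: contract_zero)
  next
    case (Cons u us)
    show ?case
      using Cons.IH[OF alternating_Cons[OF Cons.prems]] alternating_same[OF Cons.prems, of us x vs]
      by simp
  qed
  show "alternating F \<Longrightarrow> alternating (contract \<phi> F)"
    using A B by (intro alternatingI)
qed

section \<open>Pfaffians by expansion along the first row\<close>

text \<open>The number argument counts the pairs. The value 0 on nonempty lists in the base case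
  makes the function alternating on lists of every length, so that no length hypothesis has to be
  carried along.\<close>

primrec pf_list :: "('i \<Rightarrow> 'i \<Rightarrow> 'a::comm_ring_1) \<Rightarrow> nat \<Rightarrow> 'i list \<Rightarrow> 'a" where
  "pf_list a 0 xs = (if xs = [] then 1 else 0)"
| "pf_list a (Suc n) xs = (case xs of [] \<Rightarrow> 0 | x # ys \<Rightarrow> contract (a x) (pf_list a n) ys)"

text \<open>Expanding two rows makes the dependence on \<open>x\<close> and \<open>y\<close>
  visible: for skew-symmetric \<open>a\<close> the first term is antisymmetric in them, and so is
  the double contraction by \<open>contract_contract_swap\<close>.\<close>

lemma pf_list_Cons_Cons:
  "pf_list a (Suc n) (x # y # zs) = a x y * pf_list a n zs -
     (case n of 0 \<Rightarrow> 0 | Suc m \<Rightarrow> contract (a x) (contract (a y) (pf_list a m)) zs)"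
  by (cases n) (auto simp: contract_zero)

lemma alternating_pf_list:
  assumes anti: "\<And>x y. a y x = - a x y" and diag: "\<And>x. a x x = 0"
  shows "alternating (pf_list a n)"
proof (induction n)
  case 0
  show ?case by (rule alternatingI) simp_all
next
  case (Suc n)
  note alt = alternating_contract[OF Suc]
  have "pf_list a (Suc n) (us @ x # y # vs) = - pf_list a (Suc n) (us @ y # x # vs)" for us x y vs
  proof (cases us)
    case Nil
    show ?thesis
    proof (cases n)
      case 0
      then show ?thesis using anti[of x y] by (simp only: Nil append_Nil pf_list_Cons_Cons) simp
    next
      case (Suc m)
      have "contract (a x) (contract (a y) (pf_list a m)) vs
          = - contract (a y) (contract (a x) (pf_list a m)) vs"
        by (rule contract_contract_swap)
      moreover have "a y x * pf_list a n vs = - (a x y * pf_list a n vs)"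
        by (simp add: anti[of x y])
      ultimately show ?thesis
        by (simp only: Nil append_Nil pf_list_Cons_Cons) (simp add: Suc)
    qed
  next
    case (Cons u ws)
    then show ?thesis using alternating_swap[OF alt[of "a u"], of ws x y vs] by simp
  qed
  moreover have "pf_list a (Suc n) (us @ x # x # vs) = 0" for us x vs
  proof (cases us)
    case Nil
    then show ?thesis
      by (simp only: append_Nil pf_list_Cons_Cons)
        (simp add: diag contract_contract_self split: nat.split)
  next
    case (Cons u ws)
    then show ?thesis using alternating_same[OF alt[of "a u"], of ws x vs] by simp
  qed
  ultimately show ?case by (rule alternatingI)
qed

text \<open>Schur complement, in the form of a row operation: the row of \<open>y\<close> is made to vanish on \<open>zs\<close>.\<close>

lemma pf_list_clear_row:
  assumes anti: "\<And>x y. a y x = - a x y" and diag: "\<And>x. a x x = 0"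
    and clear: "\<And>j. j \<in> set zs \<Longrightarrow> a y j + (\<Sum>k\<in>set zs. c k * a k j) = 0"
  shows "pf_list a (Suc n) (x # y # zs) = (a x y + (\<Sum>k\<in>set zs. c k * a x k)) * pf_list a n zs"
proof -
  define \<phi> where "\<phi> j = a y j + (\<Sum>k\<in>set zs. c k * a k j)" for j
  note alt = alternating_pf_list[of a, OF anti diag]
  \<comment> \<open>By definition this is the Pfaffian of \<open>k # x # zs\<close>, in which
    \<open>k\<close> occurs twice. So adding multiples of the rows \<open>k\<close> to the row of
    \<open>y\<close> changes nothing.\<close>
  have rep: "contract (a k) (pf_list a n) (x # zs) = 0" if k: "k \<in> set zs" for k
  proof -
    obtain us ws where "zs = us @ k # ws" using split_list[OF k] by blast
    then show ?thesis
      using alternating_repeat[OF alt, of "Suc n" "[]" k "x # us" ws] by simp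
  qed
  have "contract \<phi> (pf_list a n) (x # zs) = contract (a y) (pf_list a n) (x # zs)"
    unfolding \<phi>_def
    by (simp only: contract_add_left contract_sum_left[OF finite_set] contract_scale_left rep
        mult_zero_right sum.neutral_const add_0_right cong: sum.cong)
  \<comment> \<open>Row \<open>y\<close> has to stand first to be the row expanded. Only this row is
    modified, not the matching column, so no new skew-symmetric matrix arises. The sign of the
    exchange is absorbed at the end by skew symmetry in \<open>\<phi> x\<close>.\<close>
  also have "\<dots> = pf_list a (Suc n) (y # x # zs)" by simp
  also have "\<dots> = - pf_list a (Suc n) (x # y # zs)"
    using alternating_swap[OF alt, of "Suc n" "[]" y x zs] by (simp del: pf_list.simps)
  finally have "pf_list a (Suc n) (x # y # zs) = - contract \<phi> (pf_list a n) (x # zs)"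
    by simp
  also have "\<dots> = - \<phi> x * pf_list a n zs"
    using clear by (simp add: contract_eq_0[of zs \<phi>] flip: \<phi>_def)
  also have "- \<phi> x = a x y + (\<Sum>k\<in>set zs. c k * a x k)"
  proof -
    have "(\<Sum>k\<in>set zs. c k * a x k) = (\<Sum>k\<in>set zs. - (c k * a k x))"
      by (rule sum.cong[OF refl]) (subst anti, simp)
    then show ?thesis
      by (simp add: \<phi>_def sum_negf anti[of y x])
  qed
  finally show ?thesis .
qed

section \<open>Degree and top coefficient for entries linear in \<open>fps_X\<close>\<close>

lemma contract_linear_fps_nth:
  "fps_nth (contract (\<lambda>y. fps_const (e y) + fps_X * fps_const (a y)) F ys) (Suc k)
     = contract e (\<lambda>zs. fps_nth (F zs) (Suc k)) ys + contract a (\<lambda>zs. fps_nth (F zs) k) ys"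
proof (induction ys arbitrary: F)
  case (Cons y ys)
  have "fps_nth ((fps_const (e y) + fps_X * fps_const (a y)) * P) (Suc k)
      = e y * fps_nth P (Suc k) + a y * fps_nth P k" for P
    by (simp add: distrib_right mult.assoc)
  then show ?case
    by (simp only: contract.simps fps_sub_nth Cons.IH) (simp add: algebra_simps)
qed simp

text \<open>Each term of the expansion is a product of \<open>n\<close> entries of degree at most
  one, and reaches degree \<open>n\<close> only through the linear part of every factor.\<close>

lemma pf_list_linear_fps:
  fixes e a :: "'i \<Rightarrow> 'i \<Rightarrow> 'a::comm_ring_1"
  defines "b \<equiv> \<lambda>x y. fps_const (e x y) + fps_X * fps_const (a x y)"
  shows pf_list_linear_fps_beyond: "n < k \<Longrightarrow> fps_nth (pf_list b n xs) k = 0"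
    and pf_list_linear_fps_top: "fps_nth (pf_list b n xs) n = pf_list a n xs"
proof -
  have nth_step: "fps_nth (contract (b x) F ys) (Suc k)
      = contract (e x) (\<lambda>zs. fps_nth (F zs) (Suc k)) ys + contract (a x) (\<lambda>zs. fps_nth (F zs) k) ys"
    for x F ys k
    unfolding b_def by (rule contract_linear_fps_nth)
  \<comment> \<open>The two claims share one induction: in the top coefficient for
    \<open>Suc n\<close>, the constant parts \<open>e\<close> meet coefficients that vanish by the
    first claim.\<close>
  have main: "(\<forall>k>n. fps_nth (pf_list b n xs) k = 0) \<and> fps_nth (pf_list b n xs) n = pf_list a n xs" for n xs
  proof (induction n arbitrary: xs)
    case 0
    then show ?case by simp
  next
    case (Suc n)
    then have beyond: "fps_nth (pf_list b n zs) k = 0" if "k > n" for zs k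
      using that by blast
    have top: "fps_nth (pf_list b n zs) n = pf_list a n zs" for zs
      using Suc by blast
    have "fps_nth (contract (b x) (pf_list b n) ys) k = 0" if "k > Suc n" for x ys k
    proof -
      obtain k' where k': "k = Suc k'" "k' > n" using \<open>k > Suc n\<close> by (cases k) auto
      then show ?thesis
        by (simp add: nth_step beyond contract_zero)
    qed
    moreover have "fps_nth (contract (b x) (pf_list b n) ys) (Suc n) = contract (a x) (pf_list a n) ys" for x ys
      by (simp add: nth_step beyond top contract_zero)
    ultimately show ?case by (cases xs) simp_all
  qed
  show "n < k \<Longrightarrow> fps_nth (pf_list b n xs) k = 0"
    using main by blast
  show "fps_nth (pf_list b n xs) n = pf_list a n xs"
    using main by blast
qed

section \<open>Expansion of the sum over matchings\<close>

definition matchings :: "nat \<Rightarrow> nat \<Rightarrow> (nat \<Rightarrow> nat) set" where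
  "matchings s n = {\<sigma>. \<sigma> permutes {2*s + 1..2*n} \<and>
     (\<forall>i\<in>{s + 1..<n}. \<sigma> (2*i - 1) < \<sigma> (2*i + 1)) \<and> (\<forall>i\<in>{s + 1..n}. \<sigma> (2*i - 1) < \<sigma> (2*i))}"

text \<open>The labelling \<open>f\<close> allows the smaller matchings to live on the interval
  \<open>{2*s + 3..2*n}\<close>, whichever partner of \<open>2*s + 1\<close> has been
  removed.\<close>

definition pf_perm :: "(nat \<Rightarrow> nat \<Rightarrow> 'a::comm_ring_1) \<Rightarrow> nat \<Rightarrow> nat \<Rightarrow> (nat \<Rightarrow> nat) \<Rightarrow> 'a" where
  "pf_perm a s n f = (\<Sum>\<sigma>\<in>matchings s n.
     of_int (sign \<sigma>) * (\<Prod>i=s + 1..n. a (f (\<sigma> (2*i - 1))) (f (\<sigma> (2*i)))))"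

text \<open>For \<open>b \<le> j\<close>, the values at b, b+1, ... are \<open>j\<close> followed by
  the other indices in increasing order.\<close>

definition cyc :: "nat \<Rightarrow> nat \<Rightarrow> nat \<Rightarrow> nat" where
  "cyc b j k = (if k = b then j else if b < k \<and> k \<le> j then k - 1 else k)"

lemma cyc_Suc: "b \<le> j \<Longrightarrow> cyc b (Suc j) = transpose j (Suc j) \<circ> cyc b j"
  by (auto simp: fun_eq_iff cyc_def transpose_def)

lemma cyc_permutes_sign: "b \<le> j \<Longrightarrow> cyc b j permutes {b..j} \<and> sign (cyc b j) = (- 1) ^ (j - b)"
proof (induction j rule: dec_induct)
  case base
  have "cyc b b = id" by (auto simp: fun_eq_iff cyc_def)
  then show ?case by (simp only: permutes_id sign_id) simp
next
  case (step j)
  have t: "transpose j (Suc j) permutes {b..Suc j}"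
    using step.hyps by (intro permutes_swap_id) auto
  have c: "cyc b j permutes {b..Suc j}"
    using step.IH by (auto intro: permutes_subset)
  have "sign (cyc b (Suc j)) = sign (transpose j (Suc j)) * sign (cyc b j)"
    unfolding cyc_Suc[OF step.hyps(1)] using t c
    by (intro sign_compose) (auto simp: permutation_permutes)
  also have "\<dots> = (- 1) ^ (Suc j - b)"
    using step by (simp add: sign_swap_id Suc_diff_le)
  finally show ?case
    using permutes_compose[OF c t] by (simp only: cyc_Suc[OF step.hyps(1)] simp_thms)
qed

lemma cyc_less_iff: "b < k \<Longrightarrow> b < l \<Longrightarrow> cyc b j k < cyc b j l \<longleftrightarrow> k < l"
  by (auto simp: cyc_def)

lemma finite_matchings: "finite (matchings s n)"
  by (rule finite_subset[OF _ finite_permutations[of "{2*s + 1..2*n}"]]) (auto simp: matchings_def)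

text \<open>Values increase along the odd positions, and every even position exceeds the odd one
  before it; so the first value is the least of all.\<close>

lemma matchings_first:
  assumes \<sigma>: "\<sigma> \<in> matchings s n" and "s < n"
  shows "\<sigma> (2*s + 1) = 2*s + 1"
proof -
  have perm: "\<sigma> permutes {2*s + 1..2*n}"
    and odd: "\<And>i. s + 1 \<le> i \<Longrightarrow> i < n \<Longrightarrow> \<sigma> (2*i - 1) < \<sigma> (2*i + 1)"
    and even: "\<And>i. s + 1 \<le> i \<Longrightarrow> i \<le> n \<Longrightarrow> \<sigma> (2*i - 1) < \<sigma> (2*i)"
    using \<sigma> by (auto simp: matchings_def)
  have le_odd: "i \<le> n \<longrightarrow> \<sigma> (2*s + 1) \<le> \<sigma> (2*i - 1)" if "s + 1 \<le> i" for i
    using that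
  proof (induction i rule: dec_induct)
    case (step i)
    then show ?case using odd[of i] by auto
  qed simp
  have "\<sigma> (2*s + 1) \<le> \<sigma> k" if "k \<in> {2*s + 1..2*n}" for k
  proof (cases "even k")
    case True
    then obtain i where "k = 2*i" by blast
    then show ?thesis using that le_odd[of i] even[of i] by auto
  next
    case False
    then obtain i where "k = 2*i + 1" by (metis oddE)
    then show ?thesis using that le_odd[of "i + 1"] by auto
  qed
  moreover obtain k where "k \<in> {2*s + 1..2*n}" "\<sigma> k = 2*s + 1"
  proof -
    have "2*s + 1 \<in> \<sigma> ` {2*s + 1..2*n}"
      using permutes_image[OF perm] \<open>s < n\<close> by auto
    then show ?thesis using that by auto
  qed
  moreover have "\<sigma> (2*s + 1) \<ge> 2*s + 1"
    using permutes_in_image[OF perm, of "2*s + 1"] \<open>s < n\<close> by auto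
  ultimately show ?thesis by (metis le_antisym)
qed

text \<open>The cycle pairs \<open>2*s + 1\<close> with \<open>j\<close>. The other order conditions
  survive because \<tau> maps the positions beyond \<open>2*s + 2\<close> to themselves and
  \<open>cyc\<close> is increasing there.\<close>

lemma cyc_comp_matching:
  assumes \<tau>: "\<tau> \<in> matchings (s + 1) n" and j: "j \<in> {2*s + 2..2*n}"
  shows "cyc (2*s + 2) j \<circ> \<tau> \<in> matchings s n"
proof -
  let ?c = "cyc (2*s + 2) j"
  have perm: "\<tau> permutes {2*s + 3..2*n}"
    and odd: "\<And>i. s + 2 \<le> i \<Longrightarrow> i < n \<Longrightarrow> \<tau> (2*i - 1) < \<tau> (2*i + 1)"
    and even: "\<And>i. s + 2 \<le> i \<Longrightarrow> i \<le> n \<Longrightarrow> \<tau> (2*i - 1) < \<tau> (2*i)"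
    using \<tau> by (auto simp: matchings_def eval_nat_numeral)
  have fix1: "\<tau> (2*s + 1) = 2*s + 1" and fix2: "\<tau> (2*s + 2) = 2*s + 2"
    using permutes_not_in[OF perm] by auto
  have gt: "2*s + 2 < \<tau> k" if "2*s + 3 \<le> k" "k \<le> 2*n" for k
    using permutes_in_image[OF perm, of k] that by auto
  have "?c permutes {2*s + 1..2*n}"
    using cyc_permutes_sign[of "2*s + 2" j] j by (auto intro: permutes_subset)
  moreover have "\<tau> permutes {2*s + 1..2*n}"
    by (rule permutes_subset[OF perm]) auto
  ultimately have "?c \<circ> \<tau> permutes {2*s + 1..2*n}"
    by (rule permutes_compose[rotated])
  moreover have c1: "(?c \<circ> \<tau>) (2*s + 1) = 2*s + 1"
    by (simp only: comp_def fix1) (simp add: cyc_def)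
  moreover have "(?c \<circ> \<tau>) (2*i - 1) < (?c \<circ> \<tau>) (2*i + 1)" if "i \<in> {s + 1..<n}" for i
  proof (cases "i = s + 1")
    case True
    have "?c k > 2*s + 1" if "k > 2*s + 2" for k using that j by (auto simp: cyc_def)
    then show ?thesis using c1 gt[of "2*s + 3"] that True by (simp add: numeral_3_eq_3)
  next
    case False
    then have "s + 2 \<le> i" "i < n" using that by auto
    then show ?thesis
      using odd[of i] gt[of "2*i - 1"] gt[of "2*i + 1"] by (auto simp: cyc_less_iff)
  qed
  moreover have "(?c \<circ> \<tau>) (2*i - 1) < (?c \<circ> \<tau>) (2*i)" if "i \<in> {s + 1..n}" for i
  proof (cases "i = s + 1")
    case True
    then show ?thesis using c1 fix2 j by (simp add: cyc_def)
  next
    case False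
    then have "s + 2 \<le> i" "i \<le> n" using that by auto
    then show ?thesis
      using even[of i] gt[of "2*i - 1"] gt[of "2*i"] by (auto simp: cyc_less_iff)
  qed
  ultimately show ?thesis by (auto simp: matchings_def)
qed

text \<open>The inverse of \<open>cyc_comp_matching\<close>: the partner of \<open>2*s + 1\<close>
  is the value at position \<open>2*s + 2\<close>, and it determines the cycle to be undone.\<close>

lemma matching_strip:
  assumes \<sigma>: "\<sigma> \<in> matchings s n" and "s < n"
  defines "j \<equiv> \<sigma> (2*s + 2)"
  shows "j \<in> {2*s + 2..2*n}" and "inv_into UNIV (cyc (2*s + 2) j) \<circ> \<sigma> \<in> matchings (s + 1) n"
proof -
  let ?c = "cyc (2*s + 2) j"
  define \<tau> where "\<tau> = inv_into UNIV ?c \<circ> \<sigma>"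
  have perm: "\<sigma> permutes {2*s + 1..2*n}"
    and odd: "\<And>i. s + 1 \<le> i \<Longrightarrow> i < n \<Longrightarrow> \<sigma> (2*i - 1) < \<sigma> (2*i + 1)"
    and even: "\<And>i. s + 1 \<le> i \<Longrightarrow> i \<le> n \<Longrightarrow> \<sigma> (2*i - 1) < \<sigma> (2*i)"
    using \<sigma> by (auto simp: matchings_def)
  note first = matchings_first[OF \<sigma> \<open>s < n\<close>]
  have "j \<in> {2*s + 1..2*n}"
    unfolding j_def using permutes_in_image[OF perm, of "2*s + 2"] \<open>s < n\<close> by auto
  moreover have "j \<noteq> 2*s + 1"
    using even[of "s + 1"] \<open>s < n\<close> first unfolding j_def by auto
  ultimately show j: "j \<in> {2*s + 2..2*n}" by auto
  have cperm: "?c permutes {2*s + 1..2*n}"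
    using cyc_permutes_sign[of "2*s + 2" j] j by (auto intro: permutes_subset)
  have \<sigma>_eq: "\<sigma> k = ?c (\<tau> k)" for k
    by (simp only: \<tau>_def comp_def permutes_inverses(1)[OF cperm])
  have inv: "inv_into UNIV ?c x = y" if "?c y = x" for x y
    using that permutes_inverses(2)[OF cperm] by auto
  have "\<tau> permutes {2*s + 1..2*n}"
    unfolding \<tau>_def by (rule permutes_compose[OF perm permutes_inv[OF cperm]])
  moreover have "\<tau> (2*s + 1) = 2*s + 1"
    unfolding \<tau>_def comp_def by (rule inv) (simp only: first, simp add: cyc_def)
  moreover have "\<tau> (2*s + 2) = 2*s + 2"
    unfolding \<tau>_def comp_def by (rule inv) (simp add: j_def cyc_def)
  moreover have "x = 2*s + 1 \<or> x = 2*s + 2" if "x \<in> {2*s + 1..2*n} - {2*s + 3..2*n}" for x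
    using that by auto
  ultimately have \<tau>perm: "\<tau> permutes {2*s + 3..2*n}"
    by (metis permutes_superset)
  have gt: "2*s + 2 < \<tau> k" if "2*s + 3 \<le> k" "k \<le> 2*n" for k
    using permutes_in_image[OF \<tau>perm, of k] that by auto
  have "\<tau> (2*i - 1) < \<tau> (2*i + 1)" if "i \<in> {s + 2..<n}" for i
    using odd[of i] gt[of "2*i - 1"] gt[of "2*i + 1"] that by (auto simp: cyc_less_iff \<sigma>_eq)
  moreover have "\<tau> (2*i - 1) < \<tau> (2*i)" if "i \<in> {s + 2..n}" for i
    using even[of i] gt[of "2*i - 1"] gt[of "2*i"] that by (auto simp: cyc_less_iff \<sigma>_eq)
  ultimately show "inv_into UNIV ?c \<circ> \<sigma> \<in> matchings (s + 1) n"
    using \<tau>perm unfolding \<tau>_def[symmetric] by (auto simp: matchings_def eval_nat_numeral)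
qed

text \<open>Matchings are sorted by the partner \<open>j\<close> of the least vertex; the cycle
  supplies the sign, and its relabelling of the rest passes into \<open>f\<close>.\<close>

lemma pf_perm_expand:
  assumes "s < n"
  shows "pf_perm a s n f = (\<Sum>j\<in>{2*s + 2..2*n}.
     (- 1) ^ (j - (2*s + 2)) * a (f (2*s + 1)) (f j) * pf_perm a (s + 1) n (f \<circ> cyc (2*s + 2) j))"
proof -
  let ?b = "2*s + 2"
  let ?w = "\<lambda>\<sigma>. of_int (sign \<sigma>) * (\<Prod>i=s + 1..n. a (f (\<sigma> (2*i - 1))) (f (\<sigma> (2*i))))"
  let ?w' = "\<lambda>j \<tau>. (- 1) ^ (j - ?b) * a (f (2*s + 1)) (f j) * (of_int (sign \<tau>) *
     (\<Prod>i=s + 2..n. a (f (cyc ?b j (\<tau> (2*i - 1)))) (f (cyc ?b j (\<tau> (2*i))))))"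
  have w: "?w (cyc ?b j \<circ> \<tau>) = ?w' j \<tau>" if \<tau>: "\<tau> \<in> matchings (s + 1) n" and j: "j \<in> {?b..2*n}" for j \<tau>
  proof -
    have perm: "\<tau> permutes {2*s + 3..2*n}"
      using \<tau> by (auto simp: matchings_def eval_nat_numeral)
    have c: "cyc ?b j permutes {?b..j}" "sign (cyc ?b j) = (- 1) ^ (j - ?b)"
      using cyc_permutes_sign[of ?b j] j by auto
    have fix1: "\<tau> (2*s + 1) = 2*s + 1" and fix2: "\<tau> (2*s + 2) = 2*s + 2"
      using permutes_not_in[OF perm] by auto
    have "sign (cyc ?b j \<circ> \<tau>) = sign (cyc ?b j) * sign \<tau>"
      using c(1) perm by (intro sign_compose) (auto simp: permutation_permutes)
    moreover have "(\<Prod>i=s + 1..n. G i) = G (s + 1) * (\<Prod>i=s + 2..n. G i)" for G :: "nat \<Rightarrow> 'a"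
      using \<open>s < n\<close> by (simp add: prod.atLeast_Suc_atMost)
    moreover have "2 * (s + 1) - 1 = 2*s + 1" "2 * (s + 1) = ?b" by auto
    moreover have "cyc ?b j (2*s + 1) = 2*s + 1" "cyc ?b j ?b = j"
      by (simp_all add: cyc_def)
    ultimately show ?thesis
      by (simp only: comp_def fix1 fix2 c(2)) simp
  qed
  have "pf_perm a s n f = (\<Sum>(j, \<tau>)\<in>Sigma {?b..2*n} (\<lambda>_. matchings (s + 1) n). ?w' j \<tau>)"
    unfolding pf_perm_def
  proof (rule sum.reindex_bij_witness[of _ "\<lambda>(j, \<tau>). cyc ?b j \<circ> \<tau>"
        "\<lambda>\<sigma>. (\<sigma> ?b, inv_into UNIV (cyc ?b (\<sigma> ?b)) \<circ> \<sigma>)"])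
    fix \<sigma> assume \<sigma>: "\<sigma> \<in> matchings s n"
    note strip = matching_strip[OF \<sigma> \<open>s < n\<close>]
    then have "surj (cyc ?b (\<sigma> ?b))"
      using cyc_permutes_sign[of ?b "\<sigma> ?b"] by (metis atLeastAtMost_iff permutes_surj)
    then show eq: "(case (\<sigma> ?b, inv_into UNIV (cyc ?b (\<sigma> ?b)) \<circ> \<sigma>) of (j, \<tau>) \<Rightarrow> cyc ?b j \<circ> \<tau>) = \<sigma>"
      by (simp only: prod.case fun_eq_iff comp_def surj_f_inv_f simp_thms)
    show "(\<sigma> ?b, inv_into UNIV (cyc ?b (\<sigma> ?b)) \<circ> \<sigma>) \<in> Sigma {?b..2*n} (\<lambda>_. matchings (s + 1) n)"
      using strip by auto
    show "(case (\<sigma> ?b, inv_into UNIV (cyc ?b (\<sigma> ?b)) \<circ> \<sigma>) of (j, \<tau>) \<Rightarrow> ?w' j \<tau>) = ?w \<sigma>"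
      using w[OF strip(2,1)] eq by (simp only: prod.case)
  next
    fix p assume "p \<in> Sigma {?b..2*n} (\<lambda>_. matchings (s + 1) n)"
    then obtain j \<tau> where p: "p = (j, \<tau>)" and j: "j \<in> {?b..2*n}" and \<tau>: "\<tau> \<in> matchings (s + 1) n"
      by auto
    have "\<tau> permutes {2*s + 3..2*n}"
      using \<tau> by (auto simp: matchings_def eval_nat_numeral)
    then have "(cyc ?b j \<circ> \<tau>) ?b = j"
      using permutes_not_in[of \<tau> _ ?b] by (simp add: cyc_def)
    moreover have "inj (cyc ?b j)"
      using cyc_permutes_sign[of ?b j] j by (auto intro: permutes_inj)
    ultimately show "((case p of (j, \<tau>) \<Rightarrow> cyc ?b j \<circ> \<tau>) ?b,
        inv_into UNIV (cyc ?b ((case p of (j, \<tau>) \<Rightarrow> cyc ?b j \<circ> \<tau>) ?b)) \<circ> (case p of (j, \<tau>) \<Rightarrow> cyc ?b j \<circ> \<tau>)) = p"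
      by (simp add: p fun_eq_iff)
    show "(case p of (j, \<tau>) \<Rightarrow> cyc ?b j \<circ> \<tau>) \<in> matchings s n"
      using cyc_comp_matching[OF \<tau> j] p by simp
  qed
  also have "\<dots> = (\<Sum>j\<in>{?b..2*n}. \<Sum>\<tau>\<in>matchings (s + 1) n. ?w' j \<tau>)"
    by (rule sum.Sigma[symmetric]) (auto simp: finite_matchings)
  finally show ?thesis
    by (simp add: pf_perm_def sum_distrib_left)
qed

text \<open>Turns the relabelling of \<open>pf_perm_expand\<close> into the deletion of one entry in
  \<open>contract_conv_sum\<close>.\<close>

lemma map_cyc_upt:
  assumes "b \<le> j" "j < m"
  shows "map (cyc b j) [Suc b..<m] = take (j - b) [b..<m] @ drop (Suc (j - b)) [b..<m]"
proof (rule nth_equalityI)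
  fix i assume "i < length (map (cyc b j) [Suc b..<m])"
  then show "map (cyc b j) [Suc b..<m] ! i = (take (j - b) [b..<m] @ drop (Suc (j - b)) [b..<m]) ! i"
    using assms by (auto simp: nth_append cyc_def min_def)
qed (use assms in auto)

lemma pf_perm_eq_pf_list:
  "s \<le> n \<Longrightarrow> pf_perm a s n f = pf_list a (n - s) (map f [2*s + 1..<2*n + 1])"
proof (induction "n - s" arbitrary: s f)
  case 0
  then have "matchings s n = {id}"
    by (auto simp: matchings_def permutes_empty)
  with 0 show ?case by (simp add: pf_perm_def)
next
  case (Suc m)
  let ?b = "2*s + 2"
  have sn: "s < n" and m: "n - s = Suc m" "m = n - (s + 1)" using Suc.hyps(2) by auto
  have "[2*s + 1..<2*n + 1] = (2*s + 1) # [?b..<2*n + 1]"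
    using sn by (subst upt_conv_Cons) auto
  then have "pf_list a (n - s) (map f [2*s + 1..<2*n + 1])
      = contract (a (f (2*s + 1))) (pf_list a m) (map f [?b..<2*n + 1])"
    by (simp add: m(1))
  also have "\<dots> = (\<Sum>i<2*n + 1 - ?b. (- 1) ^ i * a (f (2*s + 1)) (f (?b + i)) *
      pf_list a m (map f (take i [?b..<2*n + 1] @ drop (Suc i) [?b..<2*n + 1])))"
    by (simp add: contract_conv_sum take_map drop_map del: upt_Suc)
  also have "\<dots> = (\<Sum>j\<in>{?b..2*n}. (- 1) ^ (j - ?b) * a (f (2*s + 1)) (f j) *
      pf_list a m (map (f \<circ> cyc ?b j) [2*s + 3..<2*n + 1]))"
  proof (rule sum.reindex_bij_witness[of _ "\<lambda>j. j - ?b" "\<lambda>i. ?b + i"])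
    fix i assume i: "i \<in> {..<2*n + 1 - ?b}"
    show "(- 1) ^ (?b + i - ?b) * a (f (2*s + 1)) (f (?b + i)) *
        pf_list a m (map (f \<circ> cyc ?b (?b + i)) [2*s + 3..<2*n + 1]) =
      (- 1) ^ i * a (f (2*s + 1)) (f (?b + i)) *
      pf_list a m (map f (take i [?b..<2*n + 1] @ drop (Suc i) [?b..<2*n + 1]))"
      using map_cyc_upt[of ?b "?b + i" "2*n + 1"] i
      by (simp add: map_map[symmetric] numeral_3_eq_3 del: map_map upt_Suc)
  qed auto
  also have "\<dots> = (\<Sum>j\<in>{?b..2*n}. (- 1) ^ (j - ?b) * a (f (2*s + 1)) (f j) *
      pf_perm a (s + 1) n (f \<circ> cyc ?b j))"
    using Suc.hyps(1)[OF m(2)] sn by (simp add: m(2) eval_nat_numeral)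
  also have "\<dots> = pf_perm a s n f"
    by (rule pf_perm_expand[OF sn, symmetric])
  finally show ?case by simp
qed

lemma pfaffian_eq_pf_list: "pfaffian n A = pf_list (entry A) n [1..<2*n + 1]"
  using pf_perm_eq_pf_list[of 0 n "entry A" id]
  by (simp add: pf_perm_def matchings_def pfaffian_def)

section \<open>The Pfaffian of a linear pencil\<close>

definition partner :: "nat \<Rightarrow> nat" where
  "partner k = (if odd k then k + 1 else k - 1)"

text \<open>For \<open>k \<ge> 1\<close>, the only nonzero entry in row \<open>k\<close> of
  \<open>J\<close>; it stands in column \<open>partner k\<close>.\<close>

definition jsgn :: "nat \<Rightarrow> 'a::comm_ring_1" where
  "jsgn k = (if odd k then 1 else - 1)"

definition jform :: "nat \<Rightarrow> nat \<Rightarrow> 'a::comm_ring_1" where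
  "jform i j = (if odd i \<and> j = i + 1 then 1 else if odd j \<and> i = j + 1 then - 1 else 0)"

text \<open>For \<open>y\<close> above \<open>h + 1\<close> this is the entry of (M J)^m S at vertex
  \<open>y\<close>, where S is column \<open>h + 1\<close>; for \<open>y = h\<close> it is the
  coefficient t_(m+1) of the PB algorithm.\<close>

primrec walk_sum :: "(nat \<Rightarrow> nat \<Rightarrow> 'a::comm_ring_1) \<Rightarrow> nat \<Rightarrow> nat \<Rightarrow> nat \<Rightarrow> nat \<Rightarrow> 'a" where
  "walk_sum a n h 0 y = a y (h + 1)"
| "walk_sum a n h (Suc m) y = (\<Sum>x\<in>{h + 2..2*n}. a y x * jsgn x * walk_sum a n h m (partner x))"

definition walk_coeff :: "(nat \<Rightarrow> nat \<Rightarrow> 'a::comm_ring_1) \<Rightarrow> nat \<Rightarrow> nat \<Rightarrow> nat \<Rightarrow> 'a" where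
  "walk_coeff a n s i = (case i of 0 \<Rightarrow> 1 | Suc m \<Rightarrow> walk_sum a n (2*s + 1) m (2*s + 1))"

lemma jform_anti: "jform j i = - (jform i j :: 'a::comm_ring_1)"
  by (auto simp: jform_def)

lemma jform_diag: "jform i i = (0 :: 'a::comm_ring_1)"
  by (auto simp: jform_def)

text \<open>The transpose of \<open>J\<close> is its inverse: \<open>jsgn k * g (partner k)\<close>
  is the entry of J g at \<open>k\<close>, and multiplying this row vector by \<open>J\<close> gives
  back g.\<close>

lemma jform_sum:
  assumes "j \<in> {2*s + 3..2*n}"
  shows "(\<Sum>k\<in>{2*s + 3..2*n}. jsgn k * g (partner k) * jform k j) = (g j :: 'a::comm_ring_1)"
proof -
  have "jsgn k * g (partner k) * jform k j = (if k = partner j then g j else 0)" for k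
    using assms by (auto simp: jsgn_def partner_def jform_def)
  moreover have "partner j \<in> {2*s + 3..2*n}"
  proof (cases "even j")
    case True
    moreover from this have "j \<noteq> 2*s + 3" by auto
    ultimately show ?thesis using assms by (auto simp: partner_def)
  next
    case False
    moreover from this have "j \<noteq> 2*n" by auto
    ultimately show ?thesis using assms by (auto simp: partner_def)
  qed
  ultimately show ?thesis by simp
qed

lemma fps_linear_mult_nth:
  "fps_nth (P * (fps_const e + fps_X * fps_const c)) 0 = fps_nth P 0 * (e :: 'a::comm_ring_1)"
  "fps_nth (P * (fps_const e + fps_X * fps_const c)) (Suc i) = fps_nth P (Suc i) * e + fps_nth P i * c"
  by (simp_all add: distrib_left mult.left_commute[of P])

text \<open>The Pfaffian of \<open>J + x A\<close>, which has the pclow sums as its coefficients, factors along the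
  blocks of \<open>J\<close>. The coefficients \<open>c\<close> of the row operation solve \<open>(J + x M) c = - x S\<close>; since
  \<open>J\<^sup>-\<^sup>1 = - J\<close>, they are \<open>c = \<Sum>i. x\<^bsup>i+1\<^esup> J (M J)\<^sup>i S\<close>.\<close>

lemma pf_list_linear_step:
  fixes a :: "nat \<Rightarrow> nat \<Rightarrow> 'a::comm_ring_1"
  assumes anti: "\<And>i j. a j i = - a i j" and diag: "\<And>i. a i i = 0" and "s < n"
  defines "b \<equiv> \<lambda>i j. fps_const (jform i j) + fps_X * fps_const (a i j)"
  shows "pf_list b (n - s) [2*s + 1..<2*n + 1] =
    Abs_fps (walk_coeff a n s) * pf_list b (n - (s + 1)) [2*s + 3..<2*n + 1]"
proof -
  let ?h = "2*s + 1" and ?zs = "[2*s + 3..<2*n + 1]"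
  define c where "c k = Abs_fps (\<lambda>i. case i of 0 \<Rightarrow> 0
      | Suc m \<Rightarrow> jsgn k * walk_sum a n ?h m (partner k))" for k
  have c0: "fps_nth (c k) 0 = 0"
    and cSuc: "fps_nth (c k) (Suc m) = jsgn k * walk_sum a n ?h m (partner k)" for k m
    by (simp_all add: c_def)
  have banti: "b j i = - b i j" for i j
    unfolding b_def jform_anti[of j i] anti[of j i] by (simp only: fps_const_neg[symmetric] mult_minus_right minus_add_distrib)
  have bdiag: "b i i = 0" for i
    by (simp add: b_def jform_diag diag)
  have zs: "set ?zs = {2*s + 3..2*n}" by (auto simp del: upt_Suc)
  have sum_a: "(\<Sum>k\<in>set ?zs. jsgn k * walk_sum a n ?h m (partner k) * a i k) = walk_sum a n ?h (Suc m) i"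
    for i m
    unfolding zs walk_sum.simps by (rule sum.cong) (auto simp: mult_ac)
  have clear: "b (?h + 1) j + (\<Sum>k\<in>set ?zs. c k * b k j) = 0" if "j \<in> set ?zs" for j
  proof (rule fps_ext)
    fix i
    have j: "j \<in> {2*s + 3..2*n}" using that unfolding zs .
    have jf: "jform (?h + 1) j = (0::'a)" using j by (auto simp: jform_def)
    show "fps_nth (b (?h + 1) j + (\<Sum>k\<in>set ?zs. c k * b k j)) i = fps_nth 0 i"
    proof (cases i)
      case 0
      have "fps_nth (\<Sum>k\<in>set ?zs. c k * b k j) 0 = 0"
        unfolding b_def fps_sum_nth fps_linear_mult_nth c0 by simp
      moreover have "fps_nth (b (?h + 1) j) 0 = 0"
        unfolding b_def jf by simp
      ultimately show ?thesis using 0 by simp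
    next
      case (Suc m)
      have b: "fps_nth (b (?h + 1) j) (Suc m) = (if m = 0 then a (?h + 1) j else 0)"
        unfolding b_def jf by simp
      \<comment> \<open>The sum telescopes: the \<open>J\<close> part of \<open>b\<close> turns the
        coefficient of index \<open>m + 1\<close> of \<open>c\<close> into \<open>walk_sum\<close>
        at \<open>j\<close>, and the \<open>a\<close> part of the coefficient before it gives the
        negative. Only for \<open>m = 0\<close> is there no earlier coefficient, and
        \<open>a j (?h + 1)\<close> is left to cancel the entry in the row being cleared.\<close>
      have "fps_nth (\<Sum>k\<in>set ?zs. c k * b k j) (Suc m)
          = walk_sum a n ?h m j + (\<Sum>k\<in>set ?zs. fps_nth (c k) m * a k j)"
        unfolding b_def fps_sum_nth fps_linear_mult_nth cSuc sum.distrib zs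
        by (simp only: jform_sum[OF j])
      also have "(\<Sum>k\<in>set ?zs. fps_nth (c k) m * a k j) = (if m = 0 then 0 else - walk_sum a n ?h m j)"
      proof (cases m)
        case 0
        then show ?thesis by (simp add: c0)
      next
        case (Suc l)
        have "(\<Sum>k\<in>set ?zs. fps_nth (c k) m * a k j)
            = - (\<Sum>k\<in>set ?zs. jsgn k * walk_sum a n ?h l (partner k) * a j k)"
          unfolding Suc cSuc sum_negf[symmetric] by (rule sum.cong[OF refl]) (subst anti, simp)
        then show ?thesis unfolding sum_a by (simp add: Suc)
      qed
      finally have "fps_nth (\<Sum>k\<in>set ?zs. c k * b k j) (Suc m) = (if m = 0 then a j (?h + 1) else 0)"
        by simp
      then show ?thesis
        using b anti[of j "?h + 1"] by (simp add: Suc)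
    qed
  qed
  have "[2*s + 1..<2*n + 1] = ?h # (?h + 1) # ?zs" and "n - s = Suc (n - (s + 1))"
    using \<open>s < n\<close> upt_conv_Cons[of ?h "2*n + 1"] upt_conv_Cons[of "?h + 1" "2*n + 1"]
    by (simp_all add: numeral_3_eq_3 del: upt_Suc)
  then have "pf_list b (n - s) [2*s + 1..<2*n + 1]
      = (b ?h (?h + 1) + (\<Sum>k\<in>set ?zs. c k * b ?h k)) * pf_list b (n - (s + 1)) ?zs"
    by (simp only: pf_list_clear_row[of b, OF banti bdiag clear])
  \<comment> \<open>The constant term 1 is the entry of \<open>J\<close> at
    \<open>(?h, ?h + 1)\<close>. Row \<open>?h\<close> of \<open>J\<close> vanishes on
    \<open>?zs\<close>, so \<open>c\<close> enters only through \<open>a\<close>.\<close>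
  also have "b ?h (?h + 1) + (\<Sum>k\<in>set ?zs. c k * b ?h k) = Abs_fps (walk_coeff a n s)"
  proof (rule fps_ext)
    fix i
    have jf0: "jform ?h k = (0::'a)" if "k \<in> set ?zs" for k
      using that by (auto simp: jform_def)
    have jf1: "jform ?h (?h + 1) = (1::'a)" by (simp add: jform_def)
    show "fps_nth (b ?h (?h + 1) + (\<Sum>k\<in>set ?zs. c k * b ?h k)) i = fps_nth (Abs_fps (walk_coeff a n s)) i"
    proof (cases i)
      case 0
      have "fps_nth (\<Sum>k\<in>set ?zs. c k * b ?h k) 0 = 0"
        unfolding b_def fps_sum_nth fps_linear_mult_nth c0 by simp
      moreover have "fps_nth (b ?h (?h + 1)) 0 = 1"
        unfolding b_def jf1 by simp
      ultimately show ?thesis using 0 by (simp add: walk_coeff_def)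
    next
      case (Suc m)
      have "fps_nth (\<Sum>k\<in>set ?zs. c k * b ?h k) (Suc m) = (\<Sum>k\<in>set ?zs. fps_nth (c k) m * a ?h k)"
        unfolding b_def fps_sum_nth fps_linear_mult_nth
        by (rule sum.cong[OF refl]) (simp only: jf0 mult_zero_right add_0)
      moreover have "fps_nth (b ?h (?h + 1)) (Suc m) = (if m = 0 then a ?h (?h + 1) else 0)"
        unfolding b_def jf1 by simp
      moreover have "(\<Sum>k\<in>set ?zs. fps_nth (c k) m * a ?h k) = (if m = 0 then 0 else walk_sum a n ?h m ?h)"
      proof (cases m)
        case 0
        then show ?thesis by (simp add: c0)
      next
        case (Suc l)
        then show ?thesis by (simp only: cSuc sum_a) simp
      qed
      ultimately show ?thesis by (simp add: Suc walk_coeff_def)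
    qed
  qed
  finally show ?thesis .
qed

section \<open>Pclows as walks\<close>

text \<open>The lower bound excludes 0, which \<open>partner\<close> fixes by truncated
  subtraction.\<close>

lemma matching_edge_iff:
  "(\<exists>j\<ge>1. e = (2*j - 1, 2*j) \<or> e = (2*j, 2*j - 1)) \<longleftrightarrow> fst e \<ge> 1 \<and> snd e = partner (fst e)"
proof
  assume "fst e \<ge> 1 \<and> snd e = partner (fst e)"
  then show "\<exists>j\<ge>1. e = (2*j - 1, 2*j) \<or> e = (2*j, 2*j - 1)"
    by (intro exI[of _ "(fst e + 1) div 2"]) (cases e; auto simp: partner_def elim!: oddE evenE)
qed (auto simp: partner_def)

lemma pclow_iff:
  "pclow V C \<longleftrightarrow> (\<exists>m\<ge>1. length C = 2*m \<and>
     (\<forall>k<2*m. fst (C ! k) \<in> V \<and> snd (C ! k) \<in> V \<and> fst (C ! k) \<noteq> snd (C ! k)) \<and>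
     (\<forall>k<2*m. snd (C ! k) = fst (C ! (Suc k mod (2*m)))) \<and>
     (\<forall>k\<in>{1..<2*m}. fst (C ! 0) < fst (C ! k)) \<and>
     (\<forall>k<m. fst (C ! (2*k + 1)) \<ge> 1 \<and> snd (C ! (2*k + 1)) = partner (fst (C ! (2*k + 1)))))"
proof -
  have reindex: "(\<forall>k\<in>{1..m}. P (2*k - 1)) \<longleftrightarrow> (\<forall>k<m. P (2*k + 1))" for P and m :: nat
  proof safe
    fix k assume *: "\<forall>k\<in>{1..m}. P (2*k - 1)" "k < m"
    show "P (2*k + 1)" using bspec[OF *(1), of "k + 1"] *(2) by simp
  next
    fix k assume *: "\<forall>k<m. P (2*k + 1)" "k \<in> {1..m}"
    then have "k - 1 < m" "2*(k - 1) + 1 = 2*k - 1" by auto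
    then show "P (2*k - 1)" using *(1) by metis
  qed
  show ?thesis
    unfolding pclow_def matching_edge_iff all_set_conv_all_nth
      reindex[of _ "\<lambda>i. fst (C ! i) \<ge> 1 \<and> snd (C ! i) = partner (fst (C ! i))"]
    by (intro ex_cong1 conj_cong refl) simp_all
qed

lemma pclowE:
  assumes "pclow V C"
  obtains m where "m \<ge> 1" "length C = 2*m"
    "\<And>k. k < 2*m \<Longrightarrow> fst (C ! k) \<in> V" "\<And>k. k < 2*m \<Longrightarrow> snd (C ! k) \<in> V"
    "\<And>k. k < 2*m \<Longrightarrow> fst (C ! k) \<noteq> snd (C ! k)"
    "\<And>k. Suc k < 2*m \<Longrightarrow> snd (C ! k) = fst (C ! Suc k)"
    "snd (C ! (2*m - 1)) = head C"
    "\<And>k. 0 < k \<Longrightarrow> k < 2*m \<Longrightarrow> head C < fst (C ! k)"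
    "\<And>k. k < m \<Longrightarrow> snd (C ! (2*k + 1)) = partner (fst (C ! (2*k + 1)))"
proof -
  obtain m where m: "m \<ge> 1" "length C = 2*m"
    and V: "\<And>k. k < 2*m \<Longrightarrow> fst (C ! k) \<in> V \<and> snd (C ! k) \<in> V \<and> fst (C ! k) \<noteq> snd (C ! k)"
    and link: "\<And>k. k < 2*m \<Longrightarrow> snd (C ! k) = fst (C ! (Suc k mod (2*m)))"
    and min: "\<And>k. k \<in> {1..<2*m} \<Longrightarrow> fst (C ! 0) < fst (C ! k)"
    and match: "\<And>k. k < m \<Longrightarrow> snd (C ! (2*k + 1)) = partner (fst (C ! (2*k + 1)))"
    using assms unfolding pclow_iff by blast
  have "snd (C ! (2*m - 1)) = head C"
    using link[of "2*m - 1"] m(1) by (simp add: head_def)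
  moreover have "snd (C ! k) = fst (C ! Suc k)" if "Suc k < 2*m" for k
    using link[of k] that by simp
  ultimately show ?thesis
    using that[of m] m V min match by (simp add: head_def)
qed

lemma pclow_vertex_ge_head:
  assumes "pclow V C" and e: "e \<in> set C"
  shows "head C \<le> fst e" "head C \<le> snd e"
proof -
  obtain m where m: "m \<ge> 1" "length C = 2*m"
    and link: "\<And>k. Suc k < 2*m \<Longrightarrow> snd (C ! k) = fst (C ! Suc k)" "snd (C ! (2*m - 1)) = head C"
    and min: "\<And>k. 0 < k \<Longrightarrow> k < 2*m \<Longrightarrow> head C < fst (C ! k)"
    using assms(1) by (elim pclowE) blast
  obtain k where k: "k < 2*m" "e = C ! k"
    using e m(2) by (metis in_set_conv_nth)
  have fst: "head C \<le> fst (C ! i)" if "i < 2*m" for i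
    using min[of i] that by (cases "i = 0") (auto simp: head_def)
  show "head C \<le> fst e" using fst k by simp
  show "head C \<le> snd e"
  proof (cases "Suc k < 2*m")
    case True
    then show ?thesis using link(1) fst k by simp
  next
    case False
    then have "k = 2*m - 1" using k by simp
    then show ?thesis using link(2) k by simp
  qed
qed

text \<open>The last edge is a matching edge and descends to the head, as the head is the least
  vertex; a descending matching edge ends at an odd vertex.\<close>

lemma pclow_head_odd:
  assumes "pclow V C"
  shows "odd (head C)"
proof -
  obtain m where m: "m \<ge> 1" "length C = 2*m"
    and last: "snd (C ! (2*m - 1)) = head C"
    and min: "\<And>k. 0 < k \<Longrightarrow> k < 2*m \<Longrightarrow> head C < fst (C ! k)"
    and match: "\<And>k. k < m \<Longrightarrow> snd (C ! (2*k + 1)) = partner (fst (C ! (2*k + 1)))"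
    using assms by (elim pclowE) blast
  have "2*(m - 1) + 1 = 2*m - 1" using m by simp
  then have "partner (fst (C ! (2*m - 1))) = head C"
    using match[of "m - 1"] last m by simp
  moreover have "head C < fst (C ! (2*m - 1))" using min[of "2*m - 1"] m by simp
  ultimately show ?thesis by (auto simp: partner_def split: if_splits; presburger)
qed

lemma pclow_head_in: "pclow V C \<Longrightarrow> head C \<in> V"
  by (elim pclowE) (simp add: head_def)

lemma pclow_length: "pclow V C \<Longrightarrow> \<exists>m. length C = 2 * Suc m"
  by (elim pclowE) (metis Suc_le_D One_nat_def)

lemma pclow_change_vertices:
  assumes "pclow V C" and "\<And>e. e \<in> set C \<Longrightarrow> fst e \<in> W \<and> snd e \<in> W"
  shows "pclow W C"
  using assms unfolding pclow_def by blast

lemma pclow_mono: "pclow V C \<Longrightarrow> V \<subseteq> W \<Longrightarrow> pclow W C"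
  unfolding pclow_def by blast

lemma pclow_vertices: "pclow V C \<Longrightarrow> e \<in> set C \<Longrightarrow> fst e \<in> V \<and> snd e \<in> V"
  unfolding pclow_def by blast

text \<open>No head equals \<open>2*s + 2\<close>, heads being odd. This is why giving up one head
  removes two vertices.\<close>

lemma pclow_restrict:
  assumes C: "pclow {2*s + 1..N} C" and "head C \<noteq> 2*s + 1"
  shows "pclow {2*s + 3..N} C"
proof (rule pclow_change_vertices[OF C])
  fix e assume e: "e \<in> set C"
  have "2*s + 1 \<le> head C" "odd (head C)"
    using pclow_head_in[OF C] pclow_head_odd[OF C] by auto
  then have "2*s + 3 \<le> head C"
    using assms(2) by presburger
  then show "fst e \<in> {2*s + 3..N} \<and> snd e \<in> {2*s + 3..N}"
    using pclow_vertex_ge_head[OF C e] pclow_vertices[OF C e] by auto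
qed

section \<open>Splitting off the pclow with the least possible head\<close>

lemma pclow_seq_Cons:
  "pclow_seq V (C # Cs) \<longleftrightarrow> pclow V C \<and> pclow_seq V Cs \<and> (\<forall>D\<in>set Cs. head C < head D)"
  by (auto simp: pclow_seq_def)

lemma pclow_seq_mono: "pclow_seq V Cs \<Longrightarrow> V \<subseteq> W \<Longrightarrow> pclow_seq W Cs"
  unfolding pclow_seq_def using pclow_mono by blast

lemma pclow_seq_restrict:
  assumes "pclow_seq {2*s + 1..N} Cs" and "\<And>C. C \<in> set Cs \<Longrightarrow> head C \<noteq> 2*s + 1"
  shows "pclow_seq {2*s + 3..N} Cs"
  using assms unfolding pclow_seq_def using pclow_restrict by blast

lemma pclow_seq_head_gt:
  "pclow_seq {2*s + 3..N} Cs \<Longrightarrow> C \<in> set Cs \<Longrightarrow> 2*s + 1 < head C"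
  unfolding pclow_seq_def using pclow_head_in by fastforce

lemma pclow_seq_Cons_first:
  assumes "head C = 2*s + 1"
  shows "pclow_seq {2*s + 1..N} (C # Cs) \<longleftrightarrow> pclow {2*s + 1..N} C \<and> pclow_seq {2*s + 3..N} Cs"
proof
  assume "pclow_seq {2*s + 1..N} (C # Cs)"
  then show "pclow {2*s + 1..N} C \<and> pclow_seq {2*s + 3..N} Cs"
    using assms by (auto simp: pclow_seq_Cons intro!: pclow_seq_restrict)
next
  assume *: "pclow {2*s + 1..N} C \<and> pclow_seq {2*s + 3..N} Cs"
  then have "pclow_seq {2*s + 1..N} Cs"
    by (auto intro: pclow_seq_mono)
  then show "pclow_seq {2*s + 1..N} (C # Cs)"
    using * assms pclow_seq_head_gt[of s N Cs] by (auto simp: pclow_seq_Cons)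
qed

text \<open>Heads increase, so if the first one is not \<open>2*s + 1\<close>, none is. The empty
  list is excluded because \<open>hd []\<close> is unspecified.\<close>

lemma pclow_seq_not_first:
  assumes "Cs \<noteq> []"
  shows "pclow_seq {2*s + 1..N} Cs \<and> head (hd Cs) \<noteq> 2*s + 1 \<longleftrightarrow> pclow_seq {2*s + 3..N} Cs"
proof
  assume *: "pclow_seq {2*s + 1..N} Cs \<and> head (hd Cs) \<noteq> 2*s + 1"
  obtain D Ds where Cs: "Cs = D # Ds" using assms by (cases Cs) auto
  have "2*s + 1 \<le> head D"
    using * pclow_head_in by (fastforce simp: Cs pclow_seq_Cons)
  then show "pclow_seq {2*s + 3..N} Cs"
    using * by (intro pclow_seq_restrict) (auto simp: Cs pclow_seq_Cons)
next
  assume *: "pclow_seq {2*s + 3..N} Cs"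
  then show "pclow_seq {2*s + 1..N} Cs \<and> head (hd Cs) \<noteq> 2*s + 1"
    using pclow_seq_head_gt[OF *, of "hd Cs"] assms by (auto intro: pclow_seq_mono)
qed

section \<open>Pclows encoded by lists of vertices\<close>

text \<open>The list holds the targets of the odd-numbered edges, the ones that carry weight; each
  even-numbered edge is then forced.\<close>

fun walk_edges :: "nat \<Rightarrow> nat list \<Rightarrow> edge list" where
  "walk_edges y [] = []"
| "walk_edges y (x # xs) = (y, x) # (x, partner x) # walk_edges (partner x) xs"

lemma length_walk_edges [simp]: "length (walk_edges y xs) = 2 * length xs"
  by (induction y xs rule: walk_edges.induct) auto

lemma nth_walk_edges:
  "k < length xs \<Longrightarrow> walk_edges y xs ! (2*k) = ((y # map partner xs) ! k, xs ! k)"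
  "k < length xs \<Longrightarrow> walk_edges y xs ! Suc (2*k) = (xs ! k, partner (xs ! k))"
proof (induction y xs arbitrary: k rule: walk_edges.induct)
  case (2 y x xs)
  {
    case 1
    then show ?case using 2(1) by (cases k) auto
  next
    case 2
    then show ?case using \<open>\<And>k. k < length xs \<Longrightarrow> walk_edges (partner x) xs ! Suc (2*k) = (xs ! k, partner (xs ! k))\<close>
      by (cases k) auto
  }
qed auto

lemma partner_first: "partner (2*s + 2) = 2*s + 1" "x \<ge> 1 \<Longrightarrow> partner x = 2*s + 1 \<Longrightarrow> x = 2*s + 2"
  by (auto simp: partner_def split: if_splits)

lemma partner_interior: "x \<in> {2*s + 3..2*n} \<Longrightarrow> partner x \<in> {2*s + 3..2*n}"
  by (auto simp: partner_def elim!: oddE evenE) presburger+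

text \<open>The closing edge must come from \<open>2*s + 2\<close>, the partner of the head. All
  earlier targets avoid both vertices, so only an arbitrary list of interior vertices remains
  free.\<close>

lemma pclow_conv_walk_edges:
  assumes C: "pclow {2*s + 1..2*n} C" and h: "head C = 2*s + 1" and len: "length C = 2 * Suc m"
  obtains xs where "length xs = m" "set xs \<subseteq> {2*s + 3..2*n}" "C = walk_edges (2*s + 1) (xs @ [2*s + 2])"
proof -
  from C obtain m' where m': "length C = 2*m'"
    and V: "\<And>k. k < 2*m' \<Longrightarrow> fst (C ! k) \<in> {2*s + 1..2*n}"
    and link: "\<And>k. Suc k < 2*m' \<Longrightarrow> snd (C ! k) = fst (C ! Suc k)" "snd (C ! (2*m' - 1)) = head C"
    and min: "\<And>k. 0 < k \<Longrightarrow> k < 2*m' \<Longrightarrow> head C < fst (C ! k)"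
    and match: "\<And>k. k < m' \<Longrightarrow> snd (C ! (2*k + 1)) = partner (fst (C ! (2*k + 1)))"
    by (elim pclowE) blast
  have [simp]: "m' = Suc m" using m' len by simp
  define v where "v k = snd (C ! (2*k))" for k
  have v: "fst (C ! (2*k + 1)) = v k" if "k < Suc m" for k
    using link(1)[of "2*k"] that by (simp add: v_def)
  have even: "C ! (2*k) = (((2*s + 1) # map partner (map v [0..<Suc m])) ! k, v k)" if "k < Suc m" for k
  proof (cases k)
    case 0
    then show ?thesis using h by (simp add: v_def head_def prod_eq_iff)
  next
    case (Suc l)
    have "fst (C ! (2*k)) = snd (C ! (2*l + 1))"
      using link(1)[of "2*l + 1"] that Suc by simp
    also have "\<dots> = partner (v l)"
      using match[of l] v[of l] that Suc by simp
    finally show ?thesis using Suc that by (simp add: v_def prod_eq_iff nth_append del: upt_Suc)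
  qed
  have odd: "C ! (2*k + 1) = (v k, partner (v k))" if "k < Suc m" for k
    using match[of k] v[of k] that by (simp add: prod_eq_iff)
  have "C = walk_edges (2*s + 1) (map v [0..<Suc m])"
  proof (rule nth_equalityI)
    fix i assume "i < length C"
    then have i: "i < 2 * Suc m" using len by simp
    show "C ! i = walk_edges (2*s + 1) (map v [0..<Suc m]) ! i"
    proof (cases "even i")
      case True
      then obtain k where "i = 2*k" by blast
      then show ?thesis using even[of k] i by (simp add: nth_walk_edges del: upt_Suc)
    next
      case False
      then obtain k where "i = 2*k + 1" by (metis oddE)
      then show ?thesis using odd[of k] i by (simp add: nth_walk_edges del: upt_Suc)
    qed
  qed (use len in simp)
  moreover have "v m = 2*s + 2"
  proof (rule partner_first(2))
    show "v m \<ge> 1" using V[of "2*m + 1"] v[of m] by simp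
    show "partner (v m) = 2*s + 1" using link(2) h odd[of m] by simp
  qed
  moreover have "v k \<in> {2*s + 3..2*n}" if "k < m" for k
  proof -
    have "v k > 2*s + 1" "v k \<le> 2*n"
      using min[of "2*k + 1"] V[of "2*k + 1"] v[of k] h that by auto
    \<comment> \<open>Reaching \<open>2*s + 2\<close> early would force a return to the head before
      the end.\<close>
    moreover have "partner (v k) > 2*s + 1"
      using min[of "2*k + 2"] link(1)[of "2*k + 1"] odd[of k] h that by simp
    then have "v k \<noteq> 2*s + 2" using partner_first(1)[of s] by auto
    ultimately show ?thesis by auto
  qed
  ultimately show ?thesis
    by (intro that[of "map v [0..<m]"]) auto
qed

text \<open>Loops arise when a target equals the vertex just reached. They are excluded here and
  come back as zero terms in \<open>sum_first_pclows\<close>.\<close>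

lemma pclow_walk_edges:
  assumes xs: "set xs \<subseteq> {2*s + 3..2*n}" and "s < n"
    and loopfree: "\<And>e. e \<in> set (walk_edges (2*s + 1) (xs @ [2*s + 2])) \<Longrightarrow> fst e \<noteq> snd e"
  shows "pclow {2*s + 1..2*n} (walk_edges (2*s + 1) (xs @ [2*s + 2]))"
    and "head (walk_edges (2*s + 1) (xs @ [2*s + 2])) = 2*s + 1"
proof -
  define ys where "ys = xs @ [2*s + 2]"
  define C where "C = walk_edges (2*s + 1) ys"
  define m where "m = Suc (length xs)"
  have len: "length ys = m" "length C = 2*m" by (simp_all add: ys_def C_def m_def)
  have ys: "ys ! k \<in> {2*s + 2..2*n}" if "k < m" for k
  proof -
    have "ys ! k \<in> set ys" using that len by simp
    then show ?thesis using xs \<open>s < n\<close> by (auto simp: ys_def)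
  qed
  have partner_ys: "partner (ys ! k) \<in> {2*s + 3..2*n}" if "Suc k < m" for k
  proof -
    have "xs ! k \<in> set xs" using that by (simp add: m_def)
    then have "xs ! k \<in> {2*s + 3..2*n}" using xs by blast
    moreover have "ys ! k = xs ! k" using that by (simp add: ys_def m_def nth_append)
    ultimately show ?thesis using partner_interior by simp
  qed
  have last: "ys ! (m - 1) = 2*s + 2" by (simp add: ys_def m_def nth_append)
  have even: "C ! (2*k) = (if k = 0 then 2*s + 1 else partner (ys ! (k - 1)), ys ! k)" if "k < m" for k
    using nth_walk_edges(1)[of k ys "2*s + 1"] that len by (cases k) (auto simp: C_def)
  have odd: "C ! (2*k + 1) = (ys ! k, partner (ys ! k))" if "k < m" for k
    using that len by (simp add: C_def nth_walk_edges)
  have split: "P i" if "i < 2*m" "\<And>k. k < m \<Longrightarrow> P (2*k)" "\<And>k. k < m \<Longrightarrow> P (2*k + 1)" for P i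
  proof (cases "even i")
    case True
    then show ?thesis using that by (auto elim!: evenE)
  next
    case False
    then obtain k where "i = 2*k + 1" by (metis oddE)
    then show ?thesis using that by auto
  qed
  have fst_even: "fst (C ! (2*k)) \<in> {2*s + 1..2*n}" "0 < k \<Longrightarrow> fst (C ! (2*k)) > 2*s + 1" if "k < m" for k
    using that partner_ys[of "k - 1"] \<open>s < n\<close> by (auto simp: even)
  have snd_odd: "snd (C ! (2*k + 1)) \<in> {2*s + 1..2*n}" if "k < m" for k
  proof (cases "Suc k < m")
    case True
    then show ?thesis using partner_ys[of k] odd[OF that] by auto
  next
    case False
    then have "k = m - 1" using that by simp
    then show ?thesis using last odd[OF that] partner_first(1)[of s] \<open>s < n\<close> by simp
  qed
  have head: "fst (C ! 0) = 2*s + 1"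
    using even[of 0] by (simp add: m_def)
  have "fst (C ! k) \<in> {2*s + 1..2*n} \<and> snd (C ! k) \<in> {2*s + 1..2*n} \<and> fst (C ! k) \<noteq> snd (C ! k)"
    if k: "k < 2*m" for k
  proof (intro conjI)
    show "fst (C ! k) \<in> {2*s + 1..2*n}"
    proof (rule split[OF k])
      show "fst (C ! (2*k + 1)) \<in> {2*s + 1..2*n}" if "k < m" for k
        using ys[OF that] odd[OF that] by auto
    qed (rule fst_even)
    show "snd (C ! k) \<in> {2*s + 1..2*n}"
    proof (rule split[OF k])
      show "snd (C ! (2*k)) \<in> {2*s + 1..2*n}" if "k < m" for k
        using ys[OF that] even[OF that] by auto
    qed (rule snd_odd)
    show "fst (C ! k) \<noteq> snd (C ! k)"
      using loopfree[of "C ! k"] k len(2) unfolding C_def ys_def by simp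
  qed
  moreover have "snd (C ! k) = fst (C ! (Suc k mod (2*m)))" if "k < 2*m" for k
  proof (rule split[OF that])
    fix k assume k: "k < m"
    then show "snd (C ! (2*k)) = fst (C ! (Suc (2*k) mod (2*m)))"
      using odd[OF k] by (simp add: even)
    show "snd (C ! (2*k + 1)) = fst (C ! (Suc (2*k + 1) mod (2*m)))"
    proof (cases "Suc k < m")
      case True
      then have "Suc (2*k + 1) mod (2*m) = 2 * Suc k" by simp
      then show ?thesis using odd[OF k] even[OF True] by simp
    next
      case False
      then have "k = m - 1" "Suc (2*k + 1) = 2*m" using k by simp_all
      then show ?thesis using odd[OF k] last head partner_first(1)[of s] by simp
    qed
  qed
  moreover have "fst (C ! 0) < fst (C ! k)" if "k \<in> {1..<2*m}" for k
  proof -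
    have "0 < k \<longrightarrow> 2*s + 1 < fst (C ! k)"
    proof (rule split[of k])
      show "0 < 2*k + 1 \<longrightarrow> 2*s + 1 < fst (C ! (2*k + 1))" if "k < m" for k
        using ys[OF that] odd[OF that] by auto
    qed (use that fst_even in auto)
    then show ?thesis using head that by simp
  qed
  moreover have "fst (C ! (2*k + 1)) \<ge> 1 \<and> snd (C ! (2*k + 1)) = partner (fst (C ! (2*k + 1)))"
    if "k < m" for k
    using ys[OF that] odd[OF that] by auto
  moreover have "m \<ge> 1" by (simp add: m_def)
  ultimately have "pclow {2*s + 1..2*n} C"
    unfolding pclow_iff using len(2) by blast
  then show "pclow {2*s + 1..2*n} (walk_edges (2*s + 1) (xs @ [2*s + 2]))"
    by (simp add: C_def ys_def)
  show "head (walk_edges (2*s + 1) (xs @ [2*s + 2])) = 2*s + 1"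
    using head by (simp add: head_def C_def ys_def)
qed

section \<open>Sums over pclow sequences\<close>

lemma fd_Nil [simp]: "fd [] = 0"
  by (simp add: fd_def)

lemma fd_Cons [simp]: "fd (e # C) = (if fst e < snd e then 1 else 0) + fd C"
proof -
  have "fd C = length (filter (\<lambda>e. fst e < snd e) C)" for C
    by (simp add: fd_def length_filter_conv_card)
  then show ?thesis by simp
qed

lemma pclow_weight_Nil [simp]: "pclow_weight A [] = 1"
  by (simp add: pclow_weight_def)

lemma pclow_weight_Cons_Cons [simp]:
  "pclow_weight A (e # e' # C) = entry_plus A e * pclow_weight A C"
proof -
  have "pclow_weight A C = (\<Prod>k<length C div 2. entry_plus A (C ! (2*k)))" for C
    by (simp add: pclow_weight_def prod.atLeast1_atMost_eq)
  then show ?thesis by (simp add: prod.lessThan_Suc_shift del: prod.lessThan_Suc)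
qed

text \<open>Entries outside the matrix are replaced by 0, so that skew symmetry holds for all indices.\<close>

definition skew_entry :: "nat \<Rightarrow> 'a::comm_ring_1 mat \<Rightarrow> nat \<Rightarrow> nat \<Rightarrow> 'a" where
  "skew_entry N A i j = (if i \<in> {1..N} \<and> j \<in> {1..N} then entry A i j else 0)"

lemma skew_entry_anti:
  assumes "skew_symmetric N A"
  shows "skew_entry N A j i = - skew_entry N A i j"
proof (cases "i \<in> {1..N} \<and> j \<in> {1..N}")
  case True
  then have "entry A j i = - entry A i j"
    using assms unfolding skew_symmetric_def by blast
  with True show ?thesis by (simp add: skew_entry_def)
qed (auto simp: skew_entry_def)

lemma skew_entry_diag:
  assumes "skew_symmetric N A"
  shows "skew_entry N A i i = 0"
proof (cases "i \<in> {1..N}")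
  case True
  then have "entry A i i = 0"
    using assms unfolding skew_symmetric_def by blast
  then show ?thesis by (simp add: skew_entry_def)
qed (auto simp: skew_entry_def)

text \<open>One term of the fully expanded \<open>walk_sum\<close>, once the closing vertex is
  appended; the sign of that vertex comes as an extra factor.\<close>

primrec walk_prod :: "(nat \<Rightarrow> nat \<Rightarrow> 'a::comm_ring_1) \<Rightarrow> nat \<Rightarrow> nat list \<Rightarrow> 'a" where
  "walk_prod a y [] = 1"
| "walk_prod a y (x # xs) = a y x * jsgn x * walk_prod a (partner x) xs"

lemma partner_in: "x \<in> {1..2*n} \<Longrightarrow> partner x \<in> {1..2*n}"
proof (cases "even x")
  case True
  moreover assume "x \<in> {1..2*n}"
  moreover from True this have "x \<noteq> 1" by auto
  ultimately show ?thesis by (auto simp: partner_def)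
next
  case False
  moreover assume "x \<in> {1..2*n}"
  moreover from False have "x \<noteq> 2*n" by auto
  ultimately show ?thesis by (auto simp: partner_def)
qed

text \<open>In either direction, the sign of the weighted edge times \<open>entry_plus\<close> is
  minus the matrix entry, and the sign of the matching edge is \<open>- jsgn x\<close>. The two
  minus signs cancel.\<close>

lemma edge_pair_value:
  fixes A :: "'a::comm_ring_1 mat"
  assumes skew: "skew_symmetric (2*n) A" and y: "y \<in> {1..2*n}" and x: "x \<in> {1..2*n}"
  shows "(- 1) ^ (if y < x then 1 else 0) * (- 1) ^ (if x < partner x then 1 else 0) * entry_plus A (y, x)
    = skew_entry (2*n) A y x * jsgn x"
proof -
  have "(- 1) ^ (if x < partner x then 1 else 0) = - (jsgn x :: 'a)"
    using x by (auto simp: partner_def jsgn_def)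
  moreover have "(- 1) ^ (if y < x then 1 else 0) * entry_plus A (y, x) = - skew_entry (2*n) A y x"
  proof (cases "y < x")
    case True
    then show ?thesis using x y by (simp add: entry_plus_def skew_entry_def)
  next
    case False
    then have "entry_plus A (y, x) = skew_entry (2*n) A x y"
      using x y by (simp add: entry_plus_def skew_entry_def)
    then show ?thesis using False skew_entry_anti[OF skew, of x y] by simp
  qed
  ultimately show ?thesis by (simp add: mult.assoc mult.left_commute)
qed

lemma walk_edges_value:
  assumes skew: "skew_symmetric (2*n) A" and "y \<in> {1..2*n}" and "set xs \<subseteq> {1..2*n}"
  shows "(- 1) ^ fd (walk_edges y xs) * pclow_weight A (walk_edges y xs)
    = walk_prod (skew_entry (2*n) A) y xs"
  using assms(2,3)
proof (induction xs arbitrary: y)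
  case (Cons x xs)
  have IH: "(- 1) ^ fd (walk_edges (partner x) xs) * pclow_weight A (walk_edges (partner x) xs)
      = walk_prod (skew_entry (2*n) A) (partner x) xs"
    using Cons partner_in[of x n] by simp
  have "(- 1) ^ fd (walk_edges y (x # xs)) * pclow_weight A (walk_edges y (x # xs))
    = ((- 1) ^ (if y < x then 1 else 0) * (- 1) ^ (if x < partner x then 1 else 0) * entry_plus A (y, x)) *
      ((- 1) ^ fd (walk_edges (partner x) xs) * pclow_weight A (walk_edges (partner x) xs))"
    by (simp only: walk_edges.simps fd_Cons pclow_weight_Cons_Cons fst_conv snd_conv power_add mult_ac)
  then show ?case
    using edge_pair_value[OF skew, of y x] Cons.prems IH by simp
qed simp

text \<open>A matching edge at a vertex \<open>x \<ge> 1\<close> is no loop, so the loop is a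
  weighted edge and contributes a diagonal entry.\<close>

lemma walk_prod_loop:
  assumes diag: "\<And>i. a i i = 0"
    and "e \<in> set (walk_edges y xs)" and "fst e = snd e" and "\<And>x. x \<in> set xs \<Longrightarrow> x \<ge> 1"
  shows "walk_prod a y xs = 0"
  using assms(2,4)
proof (induction xs arbitrary: y)
  case (Cons x xs)
  then have "e = (y, x) \<or> e = (x, partner x) \<or> e \<in> set (walk_edges (partner x) xs)" by auto
  moreover have "x \<noteq> partner x" using Cons.prems(2)[of x] by (auto simp: partner_def)
  ultimately show ?case
    using Cons.IH[of "partner x"] Cons.prems(2) assms(3) diag by auto
qed simp

definition interior_lists :: "nat \<Rightarrow> nat \<Rightarrow> nat \<Rightarrow> nat list set" where
  "interior_lists s n m = {xs. length xs = m \<and> set xs \<subseteq> {2*s + 3..2*n}}"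

lemma finite_interior_lists: "finite (interior_lists s n m)"
  using finite_lists_length_eq[of "{2*s + 3..2*n}" m] by (simp add: interior_lists_def conj_commute)

text \<open>The minus sign is \<open>jsgn\<close> of the even closing vertex
  \<open>2*s + 2\<close>.\<close>

lemma sum_walk_prod:
  "(\<Sum>xs\<in>interior_lists s n m. walk_prod a y (xs @ [2*s + 2])) = - walk_sum a n (2*s + 1) m y"
proof (induction m arbitrary: y)
  case 0
  have "interior_lists s n 0 = {[]}" by (auto simp: interior_lists_def)
  then show ?case by (simp add: jsgn_def)
next
  case (Suc m)
  have "(\<Sum>xs\<in>interior_lists s n (Suc m). walk_prod a y (xs @ [2*s + 2]))
      = (\<Sum>(x, xs)\<in>{2*s + 3..2*n} \<times> interior_lists s n m. walk_prod a y ((x # xs) @ [2*s + 2]))"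
    by (rule sum.reindex_bij_witness[of _ "\<lambda>(x, xs). x # xs" "\<lambda>xs. (hd xs, tl xs)"])
      (auto simp: interior_lists_def length_Suc_conv)
  also have "\<dots> = (\<Sum>x\<in>{2*s + 3..2*n}. \<Sum>xs\<in>interior_lists s n m. walk_prod a y ((x # xs) @ [2*s + 2]))"
    by (rule sum.cartesian_product[symmetric])
  also have "\<dots> = (\<Sum>x\<in>{2*s + 3..2*n}. a y x * jsgn x * - walk_sum a n (2*s + 1) m (partner x))"
    by (simp only: append_Cons walk_prod.simps sum_distrib_left[symmetric] Suc)
  also have "\<dots> = - walk_sum a n (2*s + 1) (Suc m) y"
    by (simp add: sum_negf numeral_3_eq_3)
  finally show ?case .
qed

lemma walk_edges_inject: "walk_edges y xs = walk_edges y ys \<Longrightarrow> xs = ys"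
proof (induction xs arbitrary: y ys)
  case Nil
  then show ?case by (cases ys) auto
next
  case (Cons x xs)
  then show ?case by (cases ys) auto
qed

definition first_pclows :: "nat \<Rightarrow> nat \<Rightarrow> nat \<Rightarrow> edge list set" where
  "first_pclows s n m = {C. pclow {2*s + 1..2*n} C \<and> head C = 2*s + 1 \<and> length C = 2 * Suc m}"

text \<open>The exponent \<open>fd C + 1\<close> in the sign of a pclow is what makes this come out
  positive: the extra factor -1 cancels the one in \<open>sum_walk_prod\<close>.\<close>

lemma sum_first_pclows:
  fixes A :: "'a::comm_ring_1 mat"
  assumes skew: "skew_symmetric (2*n) A" and "s < n"
  shows "(\<Sum>C\<in>first_pclows s n m. pclow_sgn C * pclow_weight A C)
    = walk_coeff (skew_entry (2*n) A) n s (Suc m)"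
proof -
  let ?E = "\<lambda>xs. walk_edges (2*s + 1) (xs @ [2*s + 2])"
  let ?X = "{xs \<in> interior_lists s n m. \<forall>e\<in>set (?E xs). fst e \<noteq> snd e}"
  let ?val = "\<lambda>C. pclow_sgn C * pclow_weight A C"
  have val: "?val (?E xs) = - walk_prod (skew_entry (2*n) A) (2*s + 1) (xs @ [2*s + 2])"
    if "xs \<in> interior_lists s n m" for xs
  proof -
    have "set (xs @ [2*s + 2]) \<subseteq> {1..2*n}" "2*s + 1 \<in> {1..2*n}"
      using that \<open>s < n\<close> by (auto simp: interior_lists_def)
    then show ?thesis
      using walk_edges_value[OF skew, of "2*s + 1" "xs @ [2*s + 2]"] by (simp add: pclow_sgn_def)
  qed
  have image: "first_pclows s n m = ?E ` ?X"
  proof (intro equalityI subsetI)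
    fix C assume "C \<in> first_pclows s n m"
    then have C: "pclow {2*s + 1..2*n} C" "head C = 2*s + 1" "length C = 2 * Suc m"
      by (auto simp: first_pclows_def)
    obtain xs where xs: "length xs = m" "set xs \<subseteq> {2*s + 3..2*n}" "C = ?E xs"
      by (rule pclow_conv_walk_edges[OF C])
    moreover have "\<forall>e\<in>set C. fst e \<noteq> snd e"
      using C(1) unfolding pclow_def by blast
    ultimately show "C \<in> ?E ` ?X" by (auto simp: interior_lists_def)
  next
    fix C assume "C \<in> ?E ` ?X"
    then show "C \<in> first_pclows s n m"
      using pclow_walk_edges[OF _ \<open>s < n\<close>] by (auto simp: first_pclows_def interior_lists_def)
  qed
  have "inj_on ?E ?X"
    by (rule inj_onI) (auto dest: walk_edges_inject)
  then have "(\<Sum>C\<in>first_pclows s n m. ?val C) = (\<Sum>xs\<in>?X. ?val (?E xs))"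
    unfolding image by (simp add: sum.reindex)
  also have "\<dots> = (\<Sum>xs\<in>?X. - walk_prod (skew_entry (2*n) A) (2*s + 1) (xs @ [2*s + 2]))"
    by (rule sum.cong[OF refl], rule val) simp
  \<comment> \<open>Lists with loops may be added, since their terms contain a diagonal
    entry.\<close>
  also have "\<dots> = (\<Sum>xs\<in>interior_lists s n m. - walk_prod (skew_entry (2*n) A) (2*s + 1) (xs @ [2*s + 2]))"
  proof (rule sum.mono_neutral_left[OF finite_interior_lists])
    show "\<forall>xs\<in>interior_lists s n m - ?X. - walk_prod (skew_entry (2*n) A) (2*s + 1) (xs @ [2*s + 2]) = 0"
    proof
      fix xs assume xs: "xs \<in> interior_lists s n m - ?X"
      then obtain e where "e \<in> set (?E xs)" "fst e = snd e" by blast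
      then have "walk_prod (skew_entry (2*n) A) (2*s + 1) (xs @ [2*s + 2]) = 0"
        using xs by (intro walk_prod_loop[OF skew_entry_diag[OF skew]]) (auto simp: interior_lists_def)
      then show "- walk_prod (skew_entry (2*n) A) (2*s + 1) (xs @ [2*s + 2]) = 0" by simp
    qed
  qed auto
  also have "\<dots> = walk_coeff (skew_entry (2*n) A) n s (Suc m)"
    by (simp only: sum_negf sum_walk_prod minus_minus) (simp add: walk_coeff_def)
  finally show ?thesis .
qed

section \<open>Recursion and generating series for pclow sequences\<close>

definition pclow_sum :: "'a::comm_ring_1 mat \<Rightarrow> nat \<Rightarrow> nat \<Rightarrow> nat \<Rightarrow> 'a" where
  "pclow_sum A n s k = (\<Sum>Cs | pclow_seq {2*s + 1..2*n} Cs \<and> seq_length Cs = 2*k.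
     seq_sgn Cs * seq_weight A Cs)"

text \<open>Meaningful for \<open>k \<ge> 1\<close>, where the length rules out the empty sequence
  and with it \<open>hd []\<close>.\<close>

definition pclow_head_sum :: "'a::comm_ring_1 mat \<Rightarrow> nat \<Rightarrow> nat \<Rightarrow> nat \<Rightarrow> 'a" where
  "pclow_head_sum A n s k = (\<Sum>Cs | pclow_seq {2*s + 1..2*n} Cs \<and> seq_length Cs = 2*k \<and>
     head (hd Cs) = 2*s + 1. seq_sgn Cs * seq_weight A Cs)"

lemma seq_Nil [simp]: "seq_length [] = 0" "seq_sgn [] = 1" "seq_weight A [] = 1" "pclow_seq V []"
  by (simp_all add: seq_length_def seq_sgn_def seq_weight_def pclow_seq_def)

lemma seq_Cons [simp]:
  "seq_length (C # Cs) = length C + seq_length Cs"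
  "seq_sgn (C # Cs) = pclow_sgn C * seq_sgn Cs"
  "seq_weight A (C # Cs) = pclow_weight A C * seq_weight A Cs"
  by (simp_all add: seq_length_def seq_sgn_def seq_weight_def)

lemma seq_length_eq_0_iff: "pclow_seq V Cs \<Longrightarrow> seq_length Cs = 0 \<longleftrightarrow> Cs = []"
  by (cases Cs) (auto simp: pclow_seq_Cons dest!: pclow_length)

lemma pclow_sum_0: "pclow_sum A n s 0 = 1"
proof -
  have "{Cs. pclow_seq {2*s + 1..2*n} Cs \<and> seq_length Cs = 2*0} = {[]}"
    using seq_length_eq_0_iff by fastforce
  then show ?thesis unfolding pclow_sum_def by simp
qed

lemma pclow_sum_top: "pclow_sum A n n k = (if k = 0 then 1 else 0)"
proof (cases "k = 0")
  case False
  have "Cs = []" if "pclow_seq {2*n + 1..2*n} Cs" for Cs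
    using that by (cases Cs) (auto simp: pclow_seq_Cons dest: pclow_head_in)
  then have "{Cs. pclow_seq {2*n + 1..2*n} Cs \<and> seq_length Cs = 2*k} = {}"
    using False by fastforce
  then show ?thesis using False by (simp only: pclow_sum_def sum.empty) simp
qed (simp add: pclow_sum_0)

lemma pclow_sum_split:
  assumes "k \<ge> 1"
  shows "pclow_sum A n s k = pclow_head_sum A n s k + pclow_sum A n (s + 1) k"
proof -
  let ?S = "{Cs. pclow_seq {2*s + 1..2*n} Cs \<and> seq_length Cs = 2*k}"
  let ?H = "{Cs. pclow_seq {2*s + 1..2*n} Cs \<and> seq_length Cs = 2*k \<and> head (hd Cs) = 2*s + 1}"
  let ?T = "{Cs. pclow_seq {2*s + 3..2*n} Cs \<and> seq_length Cs = 2*k}"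
  have "Cs \<noteq> []" if "seq_length Cs = 2*k" for Cs using that assms by auto
  then have "?T = {Cs. pclow_seq {2*s + 1..2*n} Cs \<and> seq_length Cs = 2*k \<and> head (hd Cs) \<noteq> 2*s + 1}"
    using pclow_seq_not_first[of _ s "2*n"] by blast
  then have "?S = ?H \<union> ?T" "?H \<inter> ?T = {}" by auto
  moreover have "finite ?S" by (rule finite_pclow_seqs) simp
  ultimately have "(\<Sum>Cs\<in>?S. seq_sgn Cs * seq_weight A Cs)
      = (\<Sum>Cs\<in>?H. seq_sgn Cs * seq_weight A Cs) + (\<Sum>Cs\<in>?T. seq_sgn Cs * seq_weight A Cs)"
    by (metis (no_types, lifting) sum.union_disjoint finite_Un)
  then show ?thesis
    by (simp add: pclow_sum_def pclow_head_sum_def numeral_3_eq_3)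
qed

lemma pclow_head_sum_conv:
  assumes skew: "skew_symmetric (2*n) A" and "s < n" and "k \<ge> 1"
  shows "pclow_head_sum A n s k
    = (\<Sum>m<k. walk_coeff (skew_entry (2*n) A) n s (Suc m) * pclow_sum A n (s + 1) (k - Suc m))"
proof -
  let ?S = "\<lambda>m. {Cs. pclow_seq {2*s + 3..2*n} Cs \<and> seq_length Cs = 2 * (k - Suc m)}"
  let ?val = "\<lambda>Cs. seq_sgn Cs * seq_weight A Cs"
  have fin: "finite (first_pclows s n m)" for m
  proof (rule finite_subset)
    show "first_pclows s n m \<subseteq> {C. set C \<subseteq> {2*s + 1..2*n} \<times> {2*s + 1..2*n} \<and> length C = 2 * Suc m}"
      unfolding first_pclows_def pclow_def by auto
  qed (rule finite_lists_length_eq, simp)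
  have "pclow_head_sum A n s k
      = (\<Sum>(m, C, Cs)\<in>Sigma {..<k} (\<lambda>m. first_pclows s n m \<times> ?S m). ?val (C # Cs))"
    unfolding pclow_head_sum_def
  \<comment> \<open>The witness \<open>length (hd Cs) div 2 - 1\<close> inverts
    \<open>length C = 2 * Suc m\<close> in \<open>first_pclows\<close>.\<close>
  proof (rule sum.reindex_bij_witness[of _ "\<lambda>(m, C, Cs). C # Cs"
        "\<lambda>Cs. (length (hd Cs) div 2 - 1, hd Cs, tl Cs)"])
    fix Cs
    assume "Cs \<in> {Cs. pclow_seq {2*s + 1..2*n} Cs \<and> seq_length Cs = 2*k \<and> head (hd Cs) = 2*s + 1}"
    then have Cs: "pclow_seq {2*s + 1..2*n} Cs" "seq_length Cs = 2*k" "head (hd Cs) = 2*s + 1" by auto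
    then obtain D Ds where DDs: "Cs = D # Ds" using \<open>k \<ge> 1\<close> by (cases Cs) auto
    have D: "pclow {2*s + 1..2*n} D" "pclow_seq {2*s + 3..2*n} Ds"
      using Cs DDs pclow_seq_Cons_first[of D s "2*n" Ds] by auto
    obtain m where m: "length D = 2 * Suc m" using pclow_length[OF D(1)] by blast
    show "(case (length (hd Cs) div 2 - 1, hd Cs, tl Cs) of (m, C, Cs) \<Rightarrow> C # Cs) = Cs"
      by (simp add: DDs)
    show "(length (hd Cs) div 2 - 1, hd Cs, tl Cs) \<in> Sigma {..<k} (\<lambda>m. first_pclows s n m \<times> ?S m)"
      using Cs D m by (auto simp: DDs first_pclows_def)
    show "(case (length (hd Cs) div 2 - 1, hd Cs, tl Cs) of (m, C, Cs) \<Rightarrow> ?val (C # Cs)) = ?val Cs"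
      by (simp add: DDs)
  next
    fix p assume "p \<in> Sigma {..<k} (\<lambda>m. first_pclows s n m \<times> ?S m)"
    then obtain m C Cs where p: "p = (m, C, Cs)" and m: "m < k" and C: "C \<in> first_pclows s n m"
      and Cs: "pclow_seq {2*s + 3..2*n} Cs" "seq_length Cs = 2 * (k - Suc m)" by auto
    have C': "pclow {2*s + 1..2*n} C" "head C = 2*s + 1" "length C = 2 * Suc m"
      using C by (auto simp: first_pclows_def)
    then show "(length (hd (case p of (m, C, Cs) \<Rightarrow> C # Cs)) div 2 - 1,
        hd (case p of (m, C, Cs) \<Rightarrow> C # Cs), tl (case p of (m, C, Cs) \<Rightarrow> C # Cs)) = p"
      by (simp add: p)
    have "seq_length (C # Cs) = 2*k" "pclow_seq {2*s + 1..2*n} (C # Cs)"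
      using C' Cs m pclow_seq_Cons_first[of C s "2*n" Cs] by simp_all
    then show "(case p of (m, C, Cs) \<Rightarrow> C # Cs) \<in>
        {Cs. pclow_seq {2*s + 1..2*n} Cs \<and> seq_length Cs = 2*k \<and> head (hd Cs) = 2*s + 1}"
      using C' by (simp add: p del: seq_Cons(1))
  qed
  also have "\<dots> = (\<Sum>m<k. \<Sum>(C, Cs)\<in>first_pclows s n m \<times> ?S m. ?val (C # Cs))"
    using fin by (intro sum.Sigma[symmetric]) (auto intro!: finite_cartesian_product finite_pclow_seqs)
  also have "\<dots> = (\<Sum>m<k. (\<Sum>C\<in>first_pclows s n m. pclow_sgn C * pclow_weight A C) * (\<Sum>Cs\<in>?S m. ?val Cs))"
    by (simp add: sum_product sum.cartesian_product mult_ac)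
  also have "\<dots> = (\<Sum>m<k. walk_coeff (skew_entry (2*n) A) n s (Suc m) * pclow_sum A n (s + 1) (k - Suc m))"
    by (simp only: sum_first_pclows[OF skew \<open>s < n\<close>]) (simp add: pclow_sum_def numeral_3_eq_3)
  finally show ?thesis .
qed

text \<open>The term \<open>i = 0\<close> accounts for the sequences without a pclow of head
  \<open>2*s + 1\<close>; the others are split at that pclow.\<close>

lemma pclow_sum_conv:
  assumes skew: "skew_symmetric (2*n) A" and "s < n"
  shows "pclow_sum A n s k
    = (\<Sum>i=0..k. walk_coeff (skew_entry (2*n) A) n s i * pclow_sum A n (s + 1) (k - i))"
proof (cases "k = 0")
  case True
  then show ?thesis by (simp add: pclow_sum_0 walk_coeff_def)
next
  case False
  then have "pclow_sum A n s k = pclow_sum A n (s + 1) k +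
      (\<Sum>m<k. walk_coeff (skew_entry (2*n) A) n s (Suc m) * pclow_sum A n (s + 1) (k - Suc m))"
    using pclow_sum_split[of k A n s] pclow_head_sum_conv[OF skew \<open>s < n\<close>, of k] by simp
  moreover have "walk_coeff (skew_entry (2*n) A) n s 0 = 1" by (simp add: walk_coeff_def)
  ultimately show ?thesis
    by (simp add: sum.atLeast_Suc_atMost sum.atLeast1_atMost_eq)
qed

lemma pclow_sum_generating:
  fixes A :: "'a::comm_ring_1 mat"
  assumes skew: "skew_symmetric (2*n) A" and "s \<le> n"
  shows "Abs_fps (pclow_sum A n s) =
    pf_list (\<lambda>i j. fps_const (jform i j) + fps_X * fps_const (skew_entry (2*n) A i j)) (n - s) [2*s + 1..<2*n + 1]"
  using \<open>s \<le> n\<close>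
proof (induction "n - s" arbitrary: s)
  case 0
  then show ?case by (auto simp: fps_eq_iff pclow_sum_top)
next
  case (Suc d)
  then have "s < n" "d = n - (s + 1)" by auto
  have "Abs_fps (pclow_sum A n s) =
      Abs_fps (walk_coeff (skew_entry (2*n) A) n s) * Abs_fps (pclow_sum A n (s + 1))"
    by (rule fps_ext) (simp add: fps_mult_nth pclow_sum_conv[OF skew \<open>s < n\<close>])
  also have "Abs_fps (pclow_sum A n (s + 1)) =
    pf_list (\<lambda>i j. fps_const (jform i j) + fps_X * fps_const (skew_entry (2*n) A i j)) (n - (s + 1)) [2*s + 3..<2*n + 1]"
    using Suc.hyps(1)[OF \<open>d = n - (s + 1)\<close>] \<open>s < n\<close> by (simp add: numeral_3_eq_3 del: upt_Suc)
  finally show ?case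
    by (simp only: pf_list_linear_step[OF skew_entry_anti[OF skew] skew_entry_diag[OF skew] \<open>s < n\<close>])
qed

text \<open>Such sequences do exist in general; their signed weights cancel, and no pairing of them
  is exhibited.\<close>

lemma pclow_sum_beyond:
  assumes "skew_symmetric (2*n) A" and "s \<le> n" and "n - s < k"
  shows "pclow_sum A n s k = 0"
  using arg_cong[OF pclow_sum_generating[OF assms(1,2)], of "\<lambda>f. fps_nth f k"] assms(3)
  by (simp add: pf_list_linear_fps_beyond del: upt_Suc)

lemma pf_list_cong:
  "(\<And>i j. i \<in> set xs \<Longrightarrow> j \<in> set xs \<Longrightarrow> a i j = a' i j) \<Longrightarrow> pf_list a n xs = pf_list a' n xs"
proof (induction n arbitrary: xs)
  case (Suc n)
  show ?case
  proof (cases xs)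
    case (Cons x ys)
    have "pf_list a n (take j ys @ drop (Suc j) ys) = pf_list a' n (take j ys @ drop (Suc j) ys)" for j
      using Suc.prems by (intro Suc.IH) (auto simp: Cons dest: in_set_takeD in_set_dropD)
    moreover have "a x (ys ! j) = a' x (ys ! j)" if "j < length ys" for j
      using Suc.prems that by (simp add: Cons)
    ultimately show ?thesis by (simp add: Cons contract_conv_sum)
  qed simp
qed simp

lemma pclow_sum_pfaffian:
  assumes "skew_symmetric (2*n) A"
  shows "pclow_sum A n 0 n = pfaffian n A"
proof -
  have "pclow_sum A n 0 n = pf_list (skew_entry (2*n) A) n [1..<2*n + 1]"
    using arg_cong[OF pclow_sum_generating[OF assms, of 0], of "\<lambda>f. fps_nth f n"]
    by (simp add: pf_list_linear_fps_top del: upt_Suc)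
  also have "\<dots> = pf_list (entry A) n [1..<2*n + 1]"
    by (rule pf_list_cong) (auto simp: skew_entry_def)
  finally show ?thesis by (simp only: pfaffian_eq_pf_list)
qed

section \<open>The PB algorithm\<close>

text \<open>A new block goes in front and shifts the others by 2, which \<open>jform\<close> does
  not notice, as it depends only on parities and differences.\<close>

lemma Jmat_entries:
  "(Jmat m :: 'a::comm_ring_1 mat) \<in> carrier_mat (2*m) (2*m) \<and>
   (\<forall>i<2*m. \<forall>j<2*m. (Jmat m :: 'a mat) $$ (i, j) = jform (i + 1) (j + 1))"
proof (induction m)
  case 0
  then show ?case by (auto simp: Jmat_def)
next
  case (Suc m)
  let ?J = "Jmat m :: 'a mat"
  have J1: "(J1 :: 'a mat) \<in> carrier_mat 2 2"
    by (auto simp: J1_def mat_of_rows_list_def)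
  have J: "?J \<in> carrier_mat (2*m) (2*m)" and
    entries: "\<And>i j. i < 2*m \<Longrightarrow> j < 2*m \<Longrightarrow> ?J $$ (i, j) = jform (i + 1) (j + 1)"
    using Suc by auto
  have "(Jmat (Suc m) :: 'a mat) = four_block_mat J1 (0\<^sub>m 2 (2*m)) (0\<^sub>m (2*m) 2) ?J"
    using J J1 by (simp add: Jmat_def Let_def)
  moreover have "four_block_mat J1 (0\<^sub>m 2 (2*m)) (0\<^sub>m (2*m) 2) ?J $$ (i, j) = jform (i + 1) (j + 1)"
    if ij: "i < 2 * Suc m" "j < 2 * Suc m" for i j
  proof -
    have *: "four_block_mat J1 (0\<^sub>m 2 (2*m)) (0\<^sub>m (2*m) 2) ?J $$ (i, j) =
      (if i < 2 then if j < 2 then J1 $$ (i, j) else 0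
       else if j < 2 then 0 else ?J $$ (i - 2, j - 2))"
      using ij J J1 by (subst index_mat_four_block) auto
    consider "i < 2" "j < 2" | "i < 2" "j \<ge> 2" | "i \<ge> 2" "j < 2" | "i \<ge> 2" "j \<ge> 2" by linarith
    then show ?thesis
    proof cases
      case 1
      then have "i = 0 \<or> i = 1" "j = 0 \<or> j = 1" by auto
      then show ?thesis unfolding * by (auto simp: J1_def mat_of_rows_list_def jform_def)
    next
      case 4
      then obtain i' j' where "i = i' + 2" "j = j' + 2"
        by (metis le_add_diff_inverse2)
      then have "jform (i - 2 + 1) (j - 2 + 1) = (jform (i + 1) (j + 1) :: 'a)"
        by (simp add: jform_def)
      then show ?thesis unfolding * using 4 ij entries[of "i - 2" "j - 2"] by auto
    qed (auto simp: * jform_def)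
  qed
  ultimately show ?case using J J1 by auto
qed

lemma jform_row_sum:
  assumes "x \<in> {2*s + 3..2*n}"
  shows "(\<Sum>k\<in>{2*s + 3..2*n}. jform x k * g k) = (jsgn x * g (partner x) :: 'a::comm_ring_1)"
proof -
  have "jform x k * g k = (if k = partner x then jsgn x * g (partner x) else 0)" for k
    using assms by (auto simp: jsgn_def partner_def jform_def)
  then show ?thesis using partner_interior[OF assms] by simp
qed

lemma sum_interior_shift:
  fixes s n :: nat
  assumes "s < n"
  shows "(\<Sum>i\<in>{0..<2*(n - s) - 2}. g (i + (2*s + 3))) = (\<Sum>x\<in>{2*s + 3..2*n}. g x)"
proof -
  have "(\<Sum>i\<in>{0..<2*(n - s) - 2}. g (i + (2*s + 3))) = (\<Sum>x\<in>{0 + (2*s + 3)..<2*(n - s) - 2 + (2*s + 3)}. g x)"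
    by (rule sum.shift_bounds_nat_ivl[symmetric])
  also have "{0 + (2*s + 3)..<2*(n - s) - 2 + (2*s + 3)} = {2*s + 3..2*n}"
    using assms by auto
  finally show ?thesis .
qed

text \<open>Powers of matrices grow on the right, whereas \<open>walk_sum\<close> grows at the start
  of the walk, that is on the left.\<close>

lemma pow_mat_mult_vec_commute:
  assumes "Q \<in> carrier_mat N N" and "v \<in> carrier_vec N"
  shows "Q ^\<^sub>m k *\<^sub>v (Q *\<^sub>v v) = Q *\<^sub>v (Q ^\<^sub>m k *\<^sub>v v)"
  using assms(2)
proof (induction k arbitrary: v)
  case 0
  then show ?case using assms(1) by simp
next
  case (Suc k)
  have Qk: "Q ^\<^sub>m k \<in> carrier_mat N N" using assms(1) by (rule pow_carrier_mat)
  have Qv: "Q *\<^sub>v v \<in> carrier_vec N" using assms(1) Suc.prems by simp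
  have "Q ^\<^sub>m Suc k *\<^sub>v (Q *\<^sub>v v) = Q ^\<^sub>m k *\<^sub>v (Q *\<^sub>v (Q *\<^sub>v v))"
    using assoc_mult_mat_vec[OF Qk assms(1) Qv] by simp
  also have "\<dots> = Q *\<^sub>v (Q ^\<^sub>m k *\<^sub>v (Q *\<^sub>v v))"
    by (rule Suc.IH[OF Qv])
  also have "Q ^\<^sub>m k *\<^sub>v (Q *\<^sub>v v) = Q ^\<^sub>m Suc k *\<^sub>v v"
    using assoc_mult_mat_vec[OF Qk assms(1) Suc.prems] by simp
  finally show ?case .
qed

text \<open>Position \<open>i\<close> of the blocks stands for vertex \<open>i + (2*s + 3)\<close>.
  In these terms \<open>J\<close> sends g to \<open>jsgn x * g (partner x)\<close>, so each factor M
  J lengthens the walk by one weighted and one matching edge.\<close>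

lemma toeplitz_coeff_walk_coeff:
  fixes a :: "nat \<Rightarrow> nat \<Rightarrow> 'a::comm_ring_1"
  assumes B: "\<And>i j. i \<in> {1..2*(n - s)} \<Longrightarrow> j \<in> {1..2*(n - s)} \<Longrightarrow> entry B i j = a (i + 2*s) (j + 2*s)"
    and "s + 1 < n"
  shows "toeplitz_coeff (n - s) B (int k) = walk_coeff a n s k"
proof -
  let ?N = "2*(n - s) - 2" and ?h = "2*s + 1"
  let ?J = "Jmat (n - s - 1) :: 'a mat" and ?M = "blockM (n - s) B" and ?S = "blockS (n - s) B"
  have sn: "s < n" using assms(2) by simp
  have N: "2 * (n - s - 1) = ?N" by simp
  have J: "?J \<in> carrier_mat ?N ?N"
    and J_entry: "\<And>i j. i < ?N \<Longrightarrow> j < ?N \<Longrightarrow> ?J $$ (i, j) = jform (i + 1) (j + 1)"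
    using Jmat_entries[of "n - s - 1", where 'a='a] N by auto
  have M: "?M \<in> carrier_mat ?N ?N" and S: "?S \<in> carrier_vec ?N"
    by (simp_all add: blockM_def blockS_def)
  \<comment> \<open>The shift by \<open>2*s + 2\<close> is even, so \<open>J\<close> looks the same
    at every stage.\<close>
  have jshift: "jform (i + 1) (j + 1) = (jform (i + (2*s + 3)) (j + (2*s + 3)) :: 'a)" for i j
    by (auto simp: jform_def)
  have J_mult: "(?J *\<^sub>v vec ?N (\<lambda>i. g (i + (2*s + 3)))) = vec ?N (\<lambda>i. jsgn (i + (2*s + 3)) * g (partner (i + (2*s + 3))))"
    for g
  proof (rule eq_vecI)
    fix i assume "i < dim_vec (vec ?N (\<lambda>i. jsgn (i + (2*s + 3)) * g (partner (i + (2*s + 3)))))"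
    then have i: "i < ?N" by simp
    have "(?J *\<^sub>v vec ?N (\<lambda>i. g (i + (2*s + 3)))) $ i
        = (\<Sum>j\<in>{0..<?N}. ?J $$ (i, j) * g (j + (2*s + 3)))"
      using i J by (simp add: scalar_prod_def)
    also have "\<dots> = (\<Sum>j\<in>{0..<?N}. jform (i + (2*s + 3)) (j + (2*s + 3)) * g (j + (2*s + 3)))"
      using i by (intro sum.cong refl) (simp only: J_entry jshift atLeastLessThan_iff)
    also have "\<dots> = (\<Sum>x\<in>{2*s + 3..2*n}. jform (i + (2*s + 3)) x * g x)"
      by (rule sum_interior_shift[OF sn])
    also have "\<dots> = jsgn (i + (2*s + 3)) * g (partner (i + (2*s + 3)))"
      using i by (intro jform_row_sum) auto
    finally show "(?J *\<^sub>v vec ?N (\<lambda>i. g (i + (2*s + 3)))) $ i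
        = vec ?N (\<lambda>i. jsgn (i + (2*s + 3)) * g (partner (i + (2*s + 3)))) $ i"
      using i by simp
  qed (use J in simp)
  have MJ: "?M * ?J \<in> carrier_mat ?N ?N" using M J by simp
  define w where "w m = vec ?N (\<lambda>i. walk_sum a n ?h m (i + (2*s + 3)))" for m
  have w: "(?M * ?J) ^\<^sub>m m *\<^sub>v ?S = w m" for m
  proof (induction m)
    case 0
    have "?S = w 0"
      unfolding blockS_def w_def using B sn by (intro eq_vecI) (simp_all add: eval_nat_numeral)
    then show ?case using MJ S M J by simp
  next
    case (Suc m)
    have "(?M * ?J) ^\<^sub>m Suc m *\<^sub>v ?S = (?M * ?J) ^\<^sub>m m *\<^sub>v ((?M * ?J) *\<^sub>v ?S)"
      using assoc_mult_mat_vec[OF pow_carrier_mat[OF MJ] MJ S] by simp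
    also have "\<dots> = (?M * ?J) *\<^sub>v w m"
      using pow_mat_mult_vec_commute[OF MJ S] Suc by simp
    also have "\<dots> = ?M *\<^sub>v (?J *\<^sub>v w m)"
      by (rule assoc_mult_mat_vec[OF M J]) (simp add: w_def)
    also have "\<dots> = w (Suc m)"
    proof (rule eq_vecI)
      fix i assume "i < dim_vec (w (Suc m))"
      then have i: "i < ?N" by (simp add: w_def)
      have "(?M *\<^sub>v (?J *\<^sub>v w m)) $ i = (\<Sum>j\<in>{0..<?N}. a (i + (2*s + 3)) (j + (2*s + 3)) *
          (jsgn (j + (2*s + 3)) * walk_sum a n ?h m (partner (j + (2*s + 3)))))"
        unfolding w_def J_mult using i B
        by (simp add: scalar_prod_def blockM_def eval_nat_numeral)
      also have "\<dots> = (\<Sum>x\<in>{2*s + 3..2*n}. a (i + (2*s + 3)) x * (jsgn x * walk_sum a n ?h m (partner x)))"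
        by (rule sum_interior_shift[OF sn])
      finally show "(?M *\<^sub>v (?J *\<^sub>v w m)) $ i = w (Suc m) $ i"
        using i by (simp add: w_def mult.assoc numeral_3_eq_3)
    qed (use M in \<open>simp add: w_def\<close>)
    finally show ?case .
  qed
  show ?thesis
  proof (cases "k \<le> 1")
    case True
    then consider "k = 0" | "k = 1" by linarith
    then show ?thesis
      using B[of 1 2] sn by cases (auto simp: toeplitz_coeff_def walk_coeff_def)
  next
    case False
    then obtain m where k: "k = Suc (Suc m)" by (metis One_nat_def le_SucI not_less_eq_eq nat.exhaust)
    have "toeplitz_coeff (n - s) B (int k)
        = blockR (n - s) B \<bullet> ((?J * (?M * ?J) ^\<^sub>m m) *\<^sub>v ?S)"
      using k by (simp add: toeplitz_coeff_def nat_add_distrib)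
    also have "(?J * (?M * ?J) ^\<^sub>m m) *\<^sub>v ?S = ?J *\<^sub>v w m"
      using assoc_mult_mat_vec[OF J pow_carrier_mat[OF MJ] S] w by simp
    also have "blockR (n - s) B \<bullet> (?J *\<^sub>v w m) = (\<Sum>j\<in>{0..<?N}. a ?h (j + (2*s + 3)) *
          (jsgn (j + (2*s + 3)) * walk_sum a n ?h m (partner (j + (2*s + 3)))))"
      unfolding w_def J_mult using B sn
      by (simp add: scalar_prod_def blockR_def eval_nat_numeral)
    also have "\<dots> = (\<Sum>x\<in>{2*s + 3..2*n}. a ?h x * (jsgn x * walk_sum a n ?h m (partner x)))"
      by (rule sum_interior_shift[OF sn])
    also have "\<dots> = walk_coeff a n s k"
      by (simp add: k walk_coeff_def mult.assoc numeral_3_eq_3)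
    finally show ?thesis .
  qed
qed

lemma toeplitz_coeff_neg: "i < 0 \<Longrightarrow> toeplitz_coeff n B i = 0"
  by (simp add: toeplitz_coeff_def)

lemma entry_blockM:
  "i \<in> {1..2*n - 2} \<Longrightarrow> j \<in> {1..2*n - 2} \<Longrightarrow> entry (blockM n B) i j = entry B (i + 2) (j + 2)"
  by (auto simp: entry_def blockM_def)

text \<open>\<open>B\<close> is a trailing block of \<open>A\<close>, described by its entries, so
  that the induction can follow the recursion of \<open>PB\<close> through repeated
  \<open>blockM\<close>. Position \<open>k\<close> of the vector belongs to x^k, as the vector
  begins with p_n.\<close>

lemma PB_pclow_sum:
  fixes A :: "'a::comm_ring_1 mat"
  assumes skew: "skew_symmetric (2*n) A"
  shows "s < n \<Longrightarrow>
    (\<And>i j. i \<in> {1..2*(n - s)} \<Longrightarrow> j \<in> {1..2*(n - s)} \<Longrightarrow> entry B i j = skew_entry (2*n) A (i + 2*s) (j + 2*s)) \<Longrightarrow>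
    dim_vec (PB (n - s) B) = n - s + 1 \<and> (\<forall>k\<le>n - s. PB (n - s) B $ k = pclow_sum A n s k)"
proof (induction "n - s - 1" arbitrary: s B)
  case 0
  then have d: "n - s = Suc 0" "n = s + 1" by auto
  have "pclow_sum A n s (Suc 0) = walk_coeff (skew_entry (2*n) A) n s (Suc 0)"
    using pclow_sum_conv[OF skew \<open>s < n\<close>, of "Suc 0"] pclow_sum_top[of A n] by (simp add: d(2))
  also have "\<dots> = entry B 1 2"
    using 0(3)[of 1 2] by (simp add: walk_coeff_def d(1))
  finally show ?case
    by (auto simp: d(1) le_Suc_eq pclow_sum_0)
next
  case (Suc m)
  let ?B' = "blockM (n - s) B" and ?p = "PB (n - (s + 1)) (blockM (n - s) B)"
  have d: "n - s = Suc (Suc m)" "n - (s + 1) = Suc m" "m = n - (s + 1) - 1" "s + 1 < n" using Suc.hyps(2) by auto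
  have "entry ?B' i j = skew_entry (2*n) A (i + 2*(s + 1)) (j + 2*(s + 1))"
    if "i \<in> {1..2*(n - (s + 1))}" "j \<in> {1..2*(n - (s + 1))}" for i j
  proof -
    have "i \<in> {1..2*(n - s) - 2}" "j \<in> {1..2*(n - s) - 2}" using that by auto
    then show ?thesis
      using Suc.prems(2)[of "i + 2" "j + 2"] by (auto simp: entry_blockM)
  qed
  then have IH: "dim_vec ?p = n - (s + 1) + 1" "\<And>k. k \<le> n - (s + 1) \<Longrightarrow> ?p $ k = pclow_sum A n (s + 1) k"
    using Suc.hyps(1)[of "s + 1" ?B'] d by auto
  have PB: "PB (n - s) B = toeplitz_mat (n - s) B *\<^sub>v ?p"
    using d by simp
  have "PB (n - s) B $ k = pclow_sum A n s k" if k: "k \<le> n - s" for k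
  proof -
    let ?w = "walk_coeff (skew_entry (2*n) A) n s" and ?F = "pclow_sum A n (s + 1)"
    have coeff: "toeplitz_coeff (n - s) B (int k - int c) = (if c \<le> k then ?w (k - c) else 0)" for c
      using toeplitz_coeff_walk_coeff[of n s B "skew_entry (2*n) A" "k - c", OF Suc.prems(2) d(4)]
      by (auto simp: toeplitz_coeff_neg of_nat_diff)
    have "PB (n - s) B $ k = (\<Sum>c\<in>{0..<n - s}. toeplitz_coeff (n - s) B (int k - int c) * ?p $ c)"
      using k d IH(1) unfolding PB by (simp add: toeplitz_mat_def scalar_prod_def)
    also have "\<dots> = (\<Sum>c\<in>{0..<n - s}. (if c \<le> k then ?w (k - c) * ?F c else 0))"
    proof (rule sum.cong[OF refl])
      fix c assume "c \<in> {0..<n - s}"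
      then have "?p $ c = ?F c" by (intro IH(2)) auto
      then show "toeplitz_coeff (n - s) B (int k - int c) * ?p $ c = (if c \<le> k then ?w (k - c) * ?F c else 0)"
        by (simp only: coeff) simp
    qed
    \<comment> \<open>The truncation: in the last row, \<open>k = n - s\<close>, the Cauchy product
      also has a term at \<open>c = n - s\<close>, for which the Toeplitz matrix has no column. Its
      factor \<open>?F c\<close> lies beyond the degree bound for stage
      \<open>s + 1\<close>.\<close>
    also have "\<dots> = (\<Sum>c\<in>{0..k} \<union> {0..<n - s}. (if c \<le> k then ?w (k - c) * ?F c else 0))"
    proof (rule sum.mono_neutral_left)
      show "\<forall>c\<in>{0..k} \<union> {0..<n - s} - {0..<n - s}. (if c \<le> k then ?w (k - c) * ?F c else 0) = 0"
        using pclow_sum_beyond[OF skew, of "s + 1"] d by auto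
    qed auto
    also have "\<dots> = (\<Sum>c\<in>{0..k}. ?w (k - c) * ?F c)"
      by (rule sum.mono_neutral_cong_right) auto
    also have "\<dots> = (\<Sum>i\<in>{0..k}. ?w i * ?F (k - i))"
      by (rule sum.reindex_bij_witness[of _ "\<lambda>i. k - i" "\<lambda>i. k - i"]) auto
    also have "\<dots> = pclow_sum A n s k"
      using pclow_sum_conv[OF skew, of s k] d by simp
    finally show ?thesis .
  qed
  moreover have "dim_vec (PB (n - s) B) = n - s + 1"
    unfolding PB by (simp add: toeplitz_mat_def)
  ultimately show ?case by simp
qed

theorem theorem4:
  fixes A :: "'a::comm_ring_1 mat" and n :: nat
  assumes "n \<ge> 1"
    and "skew_symmetric (2*n) A"
  shows "(\<forall>k\<in>{1..n-1}.
            pf_coeff n A (n - k) =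
              (\<Sum>Cs | pclow_seq {1..2*n} Cs \<and> seq_length Cs = 2*k \<and> head (hd Cs) = 1.
                 seq_sgn Cs * seq_weight A Cs) +
              (\<Sum>Cs | pclow_seq {3..2*n} Cs \<and> seq_length Cs = 2*k.
                 seq_sgn Cs * seq_weight A Cs)) \<and>
         pf_coeff n A 0 =
           (\<Sum>Cs | pclow_seq {1..2*n} Cs \<and> seq_length Cs = 2*n \<and> head (hd Cs) = 1.
              seq_sgn Cs * seq_weight A Cs) \<and>
         pfaffian n A = pf_coeff n A 0"
proof -
  have coeff: "pf_coeff n A (n - k) = pclow_sum A n 0 k" if "k \<le> n" for k
    using PB_pclow_sum[OF assms(2), of 0 A] assms(1) that by (simp add: pf_coeff_def skew_entry_def)
  have first: "pclow_head_sum A n 0 k = (\<Sum>Cs | pclow_seq {1..2*n} Cs \<and> seq_length Cs = 2*k \<and> head (hd Cs) = 1.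
      seq_sgn Cs * seq_weight A Cs)" for k
    by (simp add: pclow_head_sum_def)
  have rest: "pclow_sum A n 1 k = (\<Sum>Cs | pclow_seq {3..2*n} Cs \<and> seq_length Cs = 2*k.
      seq_sgn Cs * seq_weight A Cs)" for k
    by (simp add: pclow_sum_def numeral_3_eq_3)
  have split: "pclow_sum A n 0 k = pclow_head_sum A n 0 k + pclow_sum A n 1 k" if "k \<ge> 1" for k
    using pclow_sum_split[OF that, of A n 0] by simp
  have "pf_coeff n A 0 = pclow_sum A n 0 n"
    using coeff[of n] by simp
  \<comment> \<open>The second sum is absent in this case because on \<open>{3..2*n}\<close> the
    index \<open>n\<close> exceeds the degree bound \<open>n - 1\<close>.\<close>
  moreover have "pclow_sum A n 0 n = pclow_head_sum A n 0 n"
    using split[of n] pclow_sum_beyond[OF assms(2), of 1 n] assms(1) by simp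
  moreover have "pfaffian n A = pclow_sum A n 0 n"
    using pclow_sum_pfaffian[OF assms(2)] by simp
  moreover have "\<forall>k\<in>{1..n-1}. pf_coeff n A (n - k) = pclow_head_sum A n 0 k + pclow_sum A n 1 k"
    using coeff split by auto
  ultimately show ?thesis unfolding first rest by simp
qed

end
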